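(* Let $u$ be a multi-circled plurisubharmonic singularity, represented by a negative multi-circled plurisubharmonic function on the unit polydisk $\mathbb{D}^n$. Then $g_u=\Psi_u$ on $\mathbb{D}^n$, where $g_u=g_{u,\mathbb{D}^n}$ is the complete greenification of $u$ at $0$ in $\mathbb{D}^n$ and $\Psi_u$ is the indicator of $u$.
   Context: A germ $u$ at $0\in\mathbb{C}^n$ of a plurisubharmonic function ($u\not\equiv-\infty$) is multi-circled if $u(z)=u(|z_1|,\dots,|z_n|)$. Up to an additive constant and replacing the germ by one differing from it by a bounded term, one may and does take $u$ to be defined, multi-circled and negative (i.e. $\le 0$) on $\mathbb{D}^n$. $\mathrm{PSH}^-(\mathbb{D}^n)$ denotes the plurisubharmonic functions $v\not\equiv-\infty$, $v\le 0$, on $\mathbb{D}^n$. Greenification: let $\mathcal F_u$ be the class of all $v\in\mathrm{PSH}^-(\mathbb{D}^n)$ such that $v\le u+O(1)$ near $0$; then $$g_u(z)=\limsup_{y\to z}\ \sup\{v(y):\ v\in\mathcal F_u\},\quad z\in\mathbb{D}^n.$$ Indicator: for $a\in\mathbb{R}^n_+=\{a\in\mathbb{R}^n: a_j>0,\ 1\le j\le n\}$ put $\phi_a(x)=\max_k a_k^{-1}\log|x_k|$ and $\nu_u(a)=\liminf_{x\to0}u(x)/\phi_a(x)$ (the Kiselman–Lelong number of $u$ at $0$ in the direction $a$). The indicator of $u$ is the function $$\Psi_u(x)=-\nu_u(-\log|x_1|,\dots,-\log|x_n|)$$ on $\mathbb{D}^n\setminus\{x_1\cdots x_n=0\}$,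 extended (uniquely) to a plurisubharmonic function on $\mathbb{D}^n$. *)

theory Defs
  imports "HOL-Analysis.Analysis"
begin

section \<open>Plurisubharmonic functions\<close>

text \<open>Functions on a domain of \<open>\<complex>\<^sup>n\<close> are total functions on \<open>complex ^ 'n\<close> with values in
  \<open>ereal\<close>; their values outside the domain play no role. The constant \<open>-\<infinity>\<close> is allowed in
  \<open>subharmonic_on\<close> and \<open>psh_on\<close>, and is excluded in \<open>PSH_neg\<close>.\<close>

definition usc_on :: "('a::topological_space \<Rightarrow> ereal) \<Rightarrow> 'a set \<Rightarrow> bool" where
  "usc_on f U \<longleftrightarrow> (\<forall>z\<in>U. Limsup (at z within U) f \<le> f z)"

text \<open>The mean of \<open>f\<close> over a circle is the quasi-integral \<open>\<integral>f\<^sup>+ - \<integral>f\<^sup>-\<close> (\<open>e2ennreal\<close> sends negative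
  values to \<open>0\<close>). An upper semicontinuous function with values below \<open>\<infinity>\<close> is bounded above on
  circles, so \<open>\<integral>f\<^sup>+\<close> is finite and the mean is a well-defined element of \<open>[-\<infinity>, \<infinity>)\<close>.\<close>

definition circle_mean :: "(complex \<Rightarrow> ereal) \<Rightarrow> complex \<Rightarrow> real \<Rightarrow> ereal" where
  "circle_mean f c r =
     (enn2ereal (\<integral>\<^sup>+t\<in>{0..2*pi}. e2ennreal (f (c + of_real r * cis t)) \<partial>lborel)
      - enn2ereal (\<integral>\<^sup>+t\<in>{0..2*pi}. e2ennreal (- f (c + of_real r * cis t)) \<partial>lborel))
     / ereal (2 * pi)"

definition subharmonic_on :: "(complex \<Rightarrow> ereal) \<Rightarrow> complex set \<Rightarrow> bool" where
  "subharmonic_on f U \<longleftrightarrow>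
     open U \<and> (\<forall>z\<in>U. f z < \<infinity>) \<and> usc_on f U \<and>
     (\<forall>c r. 0 < r \<and> cball c r \<subseteq> U \<longrightarrow> f c \<le> circle_mean f c r)"

definition psh_on :: "(complex ^ 'n \<Rightarrow> ereal) \<Rightarrow> (complex ^ 'n) set \<Rightarrow> bool" where
  "psh_on u D \<longleftrightarrow>
     open D \<and> (\<forall>z\<in>D. u z < \<infinity>) \<and> usc_on u D \<and>
     (\<forall>a b. subharmonic_on (\<lambda>\<zeta>. u (a + \<zeta> *s b)) {\<zeta>. a + \<zeta> *s b \<in> D})"

definition PSH_neg :: "(complex ^ 'n) set \<Rightarrow> (complex ^ 'n \<Rightarrow> ereal) set" where
  "PSH_neg D = {v. psh_on v D \<and> (\<forall>z\<in>D. v z \<le> 0) \<and> (\<exists>z\<in>D. v z \<noteq> -\<infinity>)}"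

definition unit_polydisk :: "(complex ^ 'n) set" where
  "unit_polydisk = {z. \<forall>j. norm (z $ j) < 1}"

definition multicircled_on :: "(complex ^ 'n \<Rightarrow> ereal) \<Rightarrow> (complex ^ 'n) set \<Rightarrow> bool" where
  "multicircled_on u D \<longleftrightarrow> (\<forall>z\<in>D. u z = u (\<chi> j. complex_of_real (norm (z $ j))))"

section \<open>Greenification\<close>

definition green_class ::
  "(complex ^ 'n) set \<Rightarrow> (complex ^ 'n \<Rightarrow> ereal) \<Rightarrow> (complex ^ 'n \<Rightarrow> ereal) set" where
  "green_class D u =
     {v \<in> PSH_neg D. \<exists>C::real. \<forall>\<^sub>F z in nhds 0. v z \<le> u z + ereal C}"

text \<open>The limsup is the upper semicontinuous regularization, so the point \<open>z\<close> itself is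
  included (\<open>nhds\<close> rather than \<open>at\<close>). For a supremum of plurisubharmonic functions this agrees
  with the limsup over \<open>y \<noteq> z\<close>.\<close>

definition greenification ::
  "(complex ^ 'n) set \<Rightarrow> (complex ^ 'n \<Rightarrow> ereal) \<Rightarrow> complex ^ 'n \<Rightarrow> ereal" where
  "greenification D u z = Limsup (nhds z) (\<lambda>y. SUP v\<in>green_class D u. v y)"

section \<open>Kiselman--Lelong numbers and the indicator\<close>

definition ereal_log :: "real \<Rightarrow> ereal" where
  "ereal_log r = (if r = 0 then -\<infinity> else ereal (ln r))"

definition phi_weight :: "real ^ 'n \<Rightarrow> complex ^ 'n \<Rightarrow> ereal" where
  "phi_weight a x = Max (range (\<lambda>k. ereal (inverse (a $ k)) * ereal_log (norm (x $ k))))"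

text \<open>For \<open>x \<noteq> 0\<close> near \<open>0\<close> the weight is a finite negative number, so the quotient is the
  expected one, with value \<open>\<infinity>\<close> where \<open>u x = -\<infinity>\<close>.\<close>

definition kiselman_lelong :: "(complex ^ 'n \<Rightarrow> ereal) \<Rightarrow> real ^ 'n \<Rightarrow> ereal" where
  "kiselman_lelong u a = Liminf (at 0) (\<lambda>x. u x / phi_weight a x)"

text \<open>The indicator is the plurisubharmonic extension to the polydisk of the function given by
  the Kiselman--Lelong numbers off the coordinate hyperplanes. The extension is unique only on the
  polydisk; \<open>extensional\<close> fixes the values elsewhere so that the description determines a total
  function.\<close>

definition psh_indicator :: "(complex ^ 'n \<Rightarrow> ereal) \<Rightarrow> complex ^ 'n \<Rightarrow> ereal" where
  "psh_indicator u =
     (THE \<Psi>. \<Psi> \<in> extensional unit_polydisk \<and> psh_on \<Psi> unit_polydisk \<and>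
        (\<forall>x\<in>unit_polydisk. (\<forall>j. x $ j \<noteq> 0) \<longrightarrow>
           \<Psi> x = - kiselman_lelong u (\<chi> j. - ln (norm (x $ j)))))"

end

theory Submission
  imports Defs "HOL-Complex_Analysis.Cauchy_Integral_Formula"
begin

text \<open>In logarithmic coordinates \<open>u\<close> is a convex function \<open>U \<le> 0\<close> on the negative orthant. Let \<open>S\<close> be the
  set of all \<open>c \<ge> 0\<close> with \<open>c \<bullet> b \<le> U b + O(1)\<close>, and \<open>\<Phi> b = sup {c \<bullet> b | c \<in> S}\<close>. A subgradient \<open>c\<close> of \<open>U\<close>
  at \<open>t b\<close> belongs to \<open>S\<close>, and \<open>U \<le> 0\<close> gives \<open>c \<bullet> b \<ge> U (t b) / t\<close>; letting \<open>t \<rightarrow> \<infinity>\<close>, the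
  Kiselman--Lelong number in direction \<open>a\<close> is \<open>- \<Phi> (- a)\<close>. On one hand the functions
  \<open>\<Sum>\<^sub>j c\<^sub>j log |z\<^sub>j|\<close> with \<open>c \<in> S\<close> are competitors for \<open>g\<^sub>u\<close>. On the other hand, for any competitor \<open>v\<close>
  the maximum over tori is convex in logarithmic coordinates, so comparing at the points \<open>b / t\<close>,
  \<open>b\<close> and \<open>t b\<close> for large \<open>t\<close> yields \<open>v \<le> \<Phi>\<close> there. Values on the coordinate hyperplanes are
  determined by upper semicontinuity and the sub-mean value inequality.\<close>

section \<open>Circle means\<close>

text \<open>The obstacle is that plurisubharmonicity gives information only on circles in complex
  lines, and a complex line is not affine in logarithmic coordinates. Convexity on tori therefore
  rests on a touching argument: if it failed, the difference of v and a strictly concave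
  perturbation of the chord would have an interior maximum, and a circle of small radius r around it
  would violate the sub-mean value inequality. The concavity costs order r^2, whereas the curvature
  of the line contributes harmonic functions of mean zero and a remainder of order r^4. No smoothing
  of v and no averaging over tori enters. The hyperplanes are handled by a single perturbation that
  replaces all zero coordinates by s: semicontinuity bounds the value at a point from below by the
  perturbed values, and the mean over a circle of radius s bounds it from above.\<close>

lemma has_integral_ln_norm_one_plus_circle:
  fixes w :: complex
  assumes "norm w < 1"
  shows "((\<lambda>t. ln (norm (1 + w * cis t))) has_integral 0) {0..2*pi}"
proof -
  have pos: "1 + w * z \<notin> \<real>\<^sub>\<le>\<^sub>0" if "z \<in> cball 0 1" for z
  proof
    assume "1 + w * z \<in> \<real>\<^sub>\<le>\<^sub>0"
    then have "Re (1 + w * z) \<le> 0"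
      by (simp add: complex_nonpos_Reals_iff)
    moreover have "\<bar>Re (w * z)\<bar> \<le> norm w * norm z"
      by (metis abs_Re_le_cmod norm_mult)
    moreover have "norm w * norm z \<le> norm w"
      using that by (simp add: mult_left_le)
    ultimately show False
      using assms by simp
  qed
  have "(\<lambda>z. Ln (1 + w * z)) holomorphic_on cball 0 1"
    using pos by (intro holomorphic_intros) auto
  \<comment> \<open>Cauchy's formula at the centre: the mean of the holomorphic branch
    \<open>Ln (1 + w * z)\<close> over the unit circle is its value \<open>Ln 1 = 0\<close>, and the
    real part of that branch is the integrand.\<close>
  then have "((\<lambda>u. Ln (1 + w * u) / (u - 0)) has_contour_integral
      (2 * of_real pi * \<i> * Ln (1 + w * 0))) (circlepath 0 1)"
    by (intro Cauchy_integral_circlepath_simple) auto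
  then have "((\<lambda>t. Ln (1 + w * (0 + of_real 1 * cis t)) / (0 + of_real 1 * cis t - 0)
      * of_real 1 * \<i> * cis t) has_integral 0) {0..2*pi}"
    unfolding circlepath_def using has_contour_integral_part_circlepath_iff[of 0 "2*pi" _ _ 0 1]
    by simp
  then have "((\<lambda>t. - \<i> * (\<i> * Ln (1 + w * cis t))) has_integral - \<i> * 0) {0..2*pi}"
    by (intro has_integral_mult_right) (simp add: mult.commute)
  then have "((\<lambda>t. Re (Ln (1 + w * cis t))) has_integral Re 0) {0..2*pi}"
    by (intro has_integral_Re) (simp flip: mult.assoc)
  moreover have "Re (Ln (1 + w * cis t)) = ln (norm (1 + w * cis t))" for t
    using pos[of "cis t"] by (intro Re_Ln) auto
  ultimately show ?thesis
    by simp
qed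

lemma has_integral_cos_period: "((\<lambda>t. cos t) has_integral (0::real)) {0..2*pi}"
proof -
  have "((\<lambda>t. cos t) has_integral (sin (2*pi) - sin (0::real))) {0..2*pi}"
    by (intro fundamental_theorem_of_calculus)
      (auto intro!: derivative_eq_intros simp flip: has_real_derivative_iff_has_vector_derivative)
  then show ?thesis by simp
qed

lemma has_integral_cos_sq_period: "((\<lambda>t. (cos t)\<^sup>2) has_integral pi) {0..2*pi}"
proof -
  let ?F = "\<lambda>t::real. t / 2 + sin t * cos t / 2"
  have "(?F has_real_derivative (cos t)\<^sup>2) (at t within {0..2*pi})" for t
  proof -
    have "(?F has_real_derivative 1 / 2 + (cos t * cos t - sin t * sin t) / 2) (at t within {0..2*pi})"
      by (auto intro!: derivative_eq_intros)
    moreover have "1 / 2 + (cos t * cos t - sin t * sin t) / 2 = (cos t)\<^sup>2"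
      using sin_cos_squared_add[of t] by (simp add: power2_eq_square field_simps)
    ultimately show ?thesis by simp
  qed
  then have "((\<lambda>t. (cos t)\<^sup>2) has_integral (?F (2*pi) - ?F 0)) {0..2*pi}"
    by (intro fundamental_theorem_of_calculus)
      (auto simp flip: has_real_derivative_iff_has_vector_derivative)
  then show ?thesis by simp
qed

lemma circle_mean_mono:
  assumes "\<And>t. f (c + of_real r * cis t) \<le> g (c + of_real r * cis t)"
  shows "circle_mean f c r \<le> circle_mean g c r"
proof -
  have "(\<integral>\<^sup>+t\<in>{0..2*pi}. e2ennreal (f (c + of_real r * cis t)) \<partial>lborel)
      \<le> (\<integral>\<^sup>+t\<in>{0..2*pi}. e2ennreal (g (c + of_real r * cis t)) \<partial>lborel)"
    by (intro nn_integral_mono mult_right_mono e2ennreal_mono assms) auto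
  moreover have "(\<integral>\<^sup>+t\<in>{0..2*pi}. e2ennreal (- g (c + of_real r * cis t)) \<partial>lborel)
      \<le> (\<integral>\<^sup>+t\<in>{0..2*pi}. e2ennreal (- f (c + of_real r * cis t)) \<partial>lborel)"
    by (intro nn_integral_mono mult_right_mono e2ennreal_mono) (auto simp: assms)
  ultimately show ?thesis
    unfolding circle_mean_def
    by (intro ereal_divide_right_mono ereal_minus_mono) (auto simp: less_eq_ennreal.rep_eq)
qed

text \<open>Continuity makes both parts of the quasi-integral finite, so their difference is the
  Lebesgue integral and hence the gauge integral. Every explicit computation of a mean goes through
  this bridge.\<close>

lemma circle_mean_of_has_integral:
  fixes h :: "real \<Rightarrow> real"
  assumes int: "(h has_integral I) {0..2*pi}" and cont: "continuous_on UNIV h"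
    and f: "\<And>t. f (c + of_real r * cis t) = ereal (h t)"
  shows "circle_mean f c r = ereal (I / (2*pi))"
proof -
  have cont': "continuous_on {0..2*pi} h"
    using cont continuous_on_subset by blast
  have ib: "set_integrable lborel {0..2*pi} h"
    by (rule borel_integrable_atLeastAtMost'[OF cont'])
  then have "(LBINT t:{0..2*pi}. h t) = I"
    using set_borel_integral_eq_integral(2)[OF ib] int by (simp add: integral_unique)
  moreover have "(LBINT t:{0..2*pi}. h t) =
      enn2real (\<integral>\<^sup>+t\<in>{0..2*pi}. ennreal (h t) \<partial>lborel) - enn2real (\<integral>\<^sup>+t\<in>{0..2*pi}. ennreal (- h t) \<partial>lborel)"
    using real_lebesgue_integral_def[of lborel "\<lambda>t. indicator {0..2*pi} t *\<^sub>R h t"] ib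
    unfolding set_integrable_def set_lebesgue_integral_def
    by (simp add: nn_integral_set_ennreal mult.commute)
  moreover have "(\<integral>\<^sup>+t\<in>{0..2*pi}. ennreal (h t) \<partial>lborel) \<noteq> top"
      "(\<integral>\<^sup>+t\<in>{0..2*pi}. ennreal (- h t) \<partial>lborel) \<noteq> top"
    using ib unfolding set_integrable_def real_integrable_def
    by (simp_all add: nn_integral_set_ennreal mult.commute)
  ultimately show ?thesis
    unfolding circle_mean_def f
    by (cases "(\<integral>\<^sup>+t\<in>{0..2*pi}. ennreal (h t) \<partial>lborel)" rule: ennreal_cases;
        cases "(\<integral>\<^sup>+t\<in>{0..2*pi}. ennreal (- h t) \<partial>lborel)" rule: ennreal_cases) auto
qed

lemma circle_mean_const: "circle_mean (\<lambda>_. ereal a) c r = ereal a"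
  using circle_mean_of_has_integral[of "\<lambda>_. a" "2*pi*a" "\<lambda>_. ereal a" c r]
    has_integral_const_real[of a 0 "2*pi"] by (simp add: mult.commute)

text \<open>For nonpositive functions the positive part drops out, and a decreasing sequence becomes
  an increasing sequence of nonnegative integrands, to which monotone convergence applies even when
  the limit takes the value -\<infinity> on the circle.\<close>

lemma circle_mean_decreasing_limit:
  fixes h :: "nat \<Rightarrow> complex \<Rightarrow> real"
  assumes cont: "\<And>n. continuous_on UNIV (\<lambda>t. h n (c + of_real r * cis t))"
    and neg: "\<And>n t. h n (c + of_real r * cis t) \<le> 0"
    and dec: "\<And>n t. h (Suc n) (c + of_real r * cis t) \<le> h n (c + of_real r * cis t)"
    and lim: "\<And>t. f (c + of_real r * cis t) = (INF n. ereal (h n (c + of_real r * cis t)))"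
    and L: "\<And>n. L \<le> circle_mean (\<lambda>\<zeta>. ereal (h n \<zeta>)) c r"
  shows "L \<le> circle_mean f c r"
proof -
  let ?z = "\<lambda>t. c + of_real r * cis t"
  have f0: "f (?z t) \<le> 0" for t
    unfolding lim using neg by (intro INF_lower2[of 0]) auto
  have m: "circle_mean (\<lambda>\<zeta>. ereal (h n \<zeta>)) c r =
      - enn2ereal (\<integral>\<^sup>+t\<in>{0..2*pi}. ennreal (- h n (?z t)) \<partial>lborel) / ereal (2*pi)" for n
    unfolding circle_mean_def using neg by (simp add: ennreal_neg zero_ennreal.rep_eq)
  have mf: "circle_mean f c r =
      - enn2ereal (\<integral>\<^sup>+t\<in>{0..2*pi}. e2ennreal (- f (?z t)) \<partial>lborel) / ereal (2*pi)"
    unfolding circle_mean_def using f0 by (simp add: e2ennreal_neg zero_ennreal.rep_eq)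
  have e: "e2ennreal (- f (?z t)) = (SUP n. ennreal (- h n (?z t)))" for t
  proof -
    have "- f (?z t) = (SUP n. - ereal (h n (?z t)))"
      unfolding lim by (rule ereal_SUP_uminus_eq[symmetric])
    moreover have "e2ennreal (SUP n. - ereal (h n (?z t))) = (SUP n. e2ennreal (- ereal (h n (?z t))))"
      using dec by (intro sup_continuousD[of e2ennreal] sup_continuous_e2ennreal)
       (auto intro!: incseq_SucI sup_continuous_id)
    ultimately show ?thesis by simp
  qed
  have "(\<integral>\<^sup>+t\<in>{0..2*pi}. e2ennreal (- f (?z t)) \<partial>lborel)
     = (\<integral>\<^sup>+t. (SUP n. ennreal (- h n (?z t)) * indicator {0..2*pi} t) \<partial>lborel)"
    unfolding e by (simp add: SUP_mult_right_ennreal)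
  also have "\<dots> = (SUP n. (\<integral>\<^sup>+t. ennreal (- h n (?z t)) * indicator {0..2*pi} t \<partial>lborel))"
  proof (rule nn_integral_monotone_convergence_SUP)
    show "incseq (\<lambda>n t. ennreal (- h n (?z t)) * indicator {0..2*pi} t)"
      using dec by (intro incseq_SucI le_funI mult_right_mono ennreal_leI) auto
    show "(\<lambda>t. ennreal (- h n (?z t)) * indicator {0..2*pi} t) \<in> borel_measurable lborel" for n
    proof -
      have [measurable]: "(\<lambda>t. h n (?z t)) \<in> borel_measurable borel"
        by (rule borel_measurable_continuous_onI[OF cont])
      show ?thesis by measurable
    qed
  qed
  finally have I: "(\<integral>\<^sup>+t\<in>{0..2*pi}. e2ennreal (- f (?z t)) \<partial>lborel) = \<dots>" .
  \<comment> \<open>Moves the bound into \<open>ennreal\<close>, where it passes to the supremum.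
    The conjunct \<open>L \<le> 0\<close> is there because \<open>e2ennreal\<close> truncates
    negative numbers to 0.\<close>
  have pw: "L \<le> - enn2ereal x / ereal (2*pi) \<longleftrightarrow> x \<le> e2ennreal (- L * ereal (2*pi)) \<and> L \<le> 0" for x
  proof (cases L)
    case (real l)
    show ?thesis
    proof (cases x rule: ennreal_cases)
      case (real y)
      have "l \<le> - y / (2*pi) \<longleftrightarrow> y \<le> - (l * (2*pi))"
        by (simp add: field_simps) linarith
      moreover have "l \<le> 0" if "y \<le> - (l * (2*pi))"
        using that real(1) pi_gt_zero by (smt (verit) mult_pos_pos)
      ultimately show ?thesis
        using real \<open>L = ereal l\<close> by (auto simp: ennreal_le_iff2 mult_nonneg_nonpos)
    next
      case top
      then show ?thesis using \<open>L = ereal l\<close> by (auto simp: top_unique)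
    qed
  next
    case PInf
    show ?thesis by (cases x rule: ennreal_cases) (auto simp: PInf)
  next
    case MInf
    show ?thesis by (cases x rule: ennreal_cases) (auto simp: MInf)
  qed
  show ?thesis
    using L unfolding m mf I pw by (auto intro!: SUP_least)
qed

section \<open>Upper semicontinuous functions\<close>

text \<open>The filter of \<open>usc_on\<close> omits the point z, but \<open>f z < y\<close> covers
  z itself, so the neighbourhood filter may replace it.\<close>

lemma usc_on_iff_open:
  assumes "open U"
  shows "usc_on f U \<longleftrightarrow> (\<forall>z\<in>U. \<forall>y>f z. \<forall>\<^sub>F x in nhds z. f x < y)"
proof -
  have "(\<forall>\<^sub>F x in at z within U. f x < y) \<longleftrightarrow> (\<forall>\<^sub>F x in nhds z. f x < y)"
    if "z \<in> U" "f z < y" for z y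
    using at_within_open[OF that(1) assms] that(2) by (simp add: eventually_nhds_conv_at)
  then show ?thesis
    unfolding usc_on_def Limsup_le_iff by blast
qed

lemma continuous_on_open_tendsto_nhds:
  assumes "continuous_on V g" "open V" "z \<in> V"
  shows "filterlim g (nhds (g z)) (nhds z)"
proof -
  have "(g \<longlongrightarrow> g z) (at z within V)"
    using assms(1,3) unfolding continuous_on_def by blast
  then have "(g \<longlongrightarrow> g z) (at z)"
    unfolding at_within_open[OF assms(3,2)] .
  then show ?thesis
    unfolding tendsto_at_iff_tendsto_nhds .
qed

lemma usc_on_compose:
  assumes "usc_on f U" "open U" "open V" "continuous_on V g" "g ` V \<subseteq> U"
  shows "usc_on (\<lambda>x. f (g x)) V"
  unfolding usc_on_iff_open[OF \<open>open V\<close>]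
proof safe
  fix z y assume z: "z \<in> V" "f (g z) < y"
  then have "\<forall>\<^sub>F x in nhds (g z). f x < y"
    using assms(1,5) unfolding usc_on_iff_open[OF \<open>open U\<close>] by auto
  moreover have "filterlim g (nhds (g z)) (nhds z)"
    using assms(3,4) z(1) by (intro continuous_on_open_tendsto_nhds)
  ultimately show "\<forall>\<^sub>F x in nhds z. f (g x) < y"
    by (rule eventually_compose_filterlim)
qed

lemma open_usc_sublevel:
  assumes "usc_on f U" "open U"
  shows "open {x \<in> U. f x < y}"
proof (rule Topological_Spaces.openI)
  fix z assume z: "z \<in> {x \<in> U. f x < y}"
  then have "\<forall>\<^sub>F x in nhds z. f x < y \<and> x \<in> U"
    using assms eventually_nhds_in_open[of U z] by (simp add: usc_on_iff_open eventually_conj_iff)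
  then show "\<exists>T. open T \<and> z \<in> T \<and> T \<subseteq> {x \<in> U. f x < y}"
    unfolding eventually_nhds by blast
qed

lemma usc_on_add_continuous:
  fixes h :: "'a::topological_space \<Rightarrow> real"
  assumes "usc_on f U" "open U" "continuous_on U h" and fin: "\<And>x. x \<in> U \<Longrightarrow> f x < \<infinity>"
  shows "usc_on (\<lambda>x. f x + ereal (h x)) U"
  unfolding usc_on_iff_open[OF \<open>open U\<close>]
proof safe
  fix z y assume z: "z \<in> U" "f z + ereal (h z) < y"
  then have "f z < y - ereal (h z)"
    by (simp add: ereal_less_minus_iff)
  then obtain a where a: "f z < ereal a" "ereal a < y - ereal (h z)"
    using ereal_dense2[of "f z" "y - ereal (h z)"] by blast
  then have "ereal (a + h z) < y"
    by (cases y) auto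
  then obtain b where b: "ereal (a + h z) < ereal b" "ereal b \<le> y"
    using ereal_dense2[of "ereal (a + h z)" y] by (auto intro: less_imp_le)
  have "\<forall>\<^sub>F x in nhds z. f x < ereal a"
    using assms(1) z(1) a(1) unfolding usc_on_iff_open[OF \<open>open U\<close>] by auto
  moreover have "filterlim h (nhds (h z)) (nhds z)"
    using assms(2,3) z(1) by (intro continuous_on_open_tendsto_nhds)
  then have "\<forall>\<^sub>F x in nhds z. h x < b - a"
    using b(1) by (intro order_tendstoD) auto
  ultimately show "\<forall>\<^sub>F x in nhds z. f x + ereal (h x) < y"
  proof eventually_elim
    case (elim x)
    then show ?case
      using b(2) by (cases "f x"; cases y) auto
  qed
qed

text \<open>Without a maximum the open sets \<open>{f < f y}\<close> with y in K would cover K; the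
  point with the largest value among those of a finite subcover is not covered.\<close>

lemma usc_attains_sup:
  assumes "usc_on f U" "open U" "compact K" "K \<noteq> {}" "K \<subseteq> U"
  shows "\<exists>x\<in>K. \<forall>y\<in>K. f y \<le> f x"
proof (rule ccontr)
  assume "\<not> ?thesis"
  then have no: "\<forall>x\<in>K. \<exists>y\<in>K. f x < f y"
    by (auto simp: not_le)
  let ?T = "\<lambda>y. {x \<in> U. f x < f y}"
  have "K \<subseteq> (\<Union>y\<in>K. ?T y)"
    using no assms(5) by blast
  then obtain C where C: "C \<subseteq> K" "finite C" "K \<subseteq> (\<Union>y\<in>C. ?T y)"
    by (rule compactE_image[OF assms(3) open_usc_sublevel[OF assms(1,2)]])
  have "C \<noteq> {}"
    using C assms(4) by auto
  then have "Max (f ` C) \<in> f ` C"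
    using C(2) by (intro Max_in) auto
  then obtain y where y: "y \<in> C" "f y = Max (f ` C)"
    by auto
  have "y \<in> K"
    using C(1) y(1) by auto
  then obtain y' where y': "y' \<in> C" "f y < f y'"
    using C(3) by auto
  have "f y' \<le> Max (f ` C)"
    using y'(1) C(2) by (intro Max_ge) auto
  then show False
    using y(2) y'(2) by auto
qed

section \<open>Logarithmic convexity\<close>

text \<open>The logarithmic image of the polydisk minus the coordinate hyperplanes.\<close>

definition neg_orthant :: "(real ^ 'n) set" where
  "neg_orthant = {b. \<forall>j. b $ j < 0}"

definition torus_point :: "real ^ 'n \<Rightarrow> real ^ 'n \<Rightarrow> complex ^ 'n" where
  "torus_point b \<theta> = (\<chi> j. of_real (exp (b $ j)) * cis (\<theta> $ j))"

lemma norm_torus_point [simp]: "norm (torus_point b \<theta> $ j) = exp (b $ j)"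
  by (simp add: torus_point_def norm_mult)

lemma open_neg_orthant: "open (neg_orthant :: (real ^ 'n) set)"
proof -
  have eq: "neg_orthant = (\<Inter>j. {b :: real ^ 'n. b $ j < 0})"
    by (auto simp: neg_orthant_def)
  moreover have "open {b :: real ^ 'n. b $ j < 0}" for j
    by (intro open_Collect_less continuous_intros)
  ultimately show ?thesis
    unfolding eq by (intro open_INT) auto
qed

lemma open_unit_polydisk: "open (unit_polydisk :: (complex ^ 'n) set)"
proof -
  have eq: "unit_polydisk = (\<Inter>j. {z :: complex ^ 'n. norm (z $ j) < 1})"
    by (auto simp: unit_polydisk_def)
  moreover have "open {z :: complex ^ 'n. norm (z $ j) < 1}" for j
    by (intro open_Collect_less continuous_intros)
  ultimately show ?thesis
    unfolding eq by (intro open_INT) auto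
qed

lemma torus_point_mem_unit_polydisk: "b \<in> neg_orthant \<Longrightarrow> torus_point b \<theta> \<in> unit_polydisk"
  by (simp add: neg_orthant_def unit_polydisk_def)

lemma continuous_on_torus_point [continuous_intros]:
  assumes "continuous_on A f" "continuous_on A g"
  shows "continuous_on A (\<lambda>x. torus_point (f x) (g x))"
  unfolding torus_point_def
  by (intro continuous_intros continuous_on_vec_lambda assms
      continuous_on_compose2[OF continuous_on_cis] continuous_on_component[OF assms(2)]) auto

text \<open>Confining the angles to a compact box is what allows maximization over tori and the tube
  lemma.\<close>

lemma ex_torus_point:
  fixes z :: "complex ^ 'n"
  assumes "\<And>j. norm (z $ j) = exp (b $ j)"
  shows "\<exists>\<theta>\<in>cbox 0 (\<chi> j. 2 * pi). z = torus_point b \<theta>"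
proof
  let ?th = "\<chi> j. Arg2pi (z $ j)"
  show "?th \<in> cbox 0 (\<chi> j. 2 * pi)"
    using Arg2pi_ge_0 Arg2pi_lt_2pi by (auto simp: mem_box_cart intro: less_imp_le)
  show "z = torus_point b ?th"
    unfolding torus_point_def vec_eq_iff
    by (simp add: cis_conv_exp Arg2pi_eq flip: assms)
qed

lemma psh_line_submean:
  assumes "psh_on v D" "0 < r" "\<And>\<zeta>. norm (\<zeta> - c) \<le> r \<Longrightarrow> a + \<zeta> *s b \<in> D"
  shows "v (a + c *s b) \<le> circle_mean (\<lambda>\<zeta>. v (a + \<zeta> *s b)) c r"
proof -
  have "subharmonic_on (\<lambda>\<zeta>. v (a + \<zeta> *s b)) {\<zeta>. a + \<zeta> *s b \<in> D}"
    using assms(1) unfolding psh_on_def by blast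
  moreover have "cball c r \<subseteq> {\<zeta>. a + \<zeta> *s b \<in> D}"
    using assms(3) by (auto simp: dist_norm norm_minus_commute)
  ultimately show ?thesis
    using assms(2) unfolding subharmonic_on_def by blast
qed

text \<open>In logarithmic coordinates the complex line \<open>\<zeta> \<mapsto> z\<^sub>0 (1 + \<zeta> d)\<close> moves in direction \<open>d\<close> up to
  an error that is harmonic and of second order, so a strictly concave quadratic in \<open>Re \<zeta>\<close> cannot
  touch \<open>v\<close> from above.\<close>

lemma psh_no_concave_touching:
  fixes v :: "complex ^ 'n \<Rightarrow> ereal" and d y :: "real ^ 'n"
  assumes psh: "psh_on v D" and v0: "v z0 = ereal v0" and "\<delta> > 0" "\<epsilon> > 0" "m \<ge> 0"
    and D: "\<And>\<zeta>. norm \<zeta> \<le> \<delta> \<Longrightarrow> (z0 + \<zeta> *s (\<chi> j. z0 $ j * of_real (d $ j))) \<in> D"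
    and touch: "\<And>\<zeta> \<sigma>. norm \<zeta> \<le> \<delta> \<Longrightarrow> (\<And>j. norm (\<zeta> * of_real (d $ j)) \<le> 1 / 2) \<Longrightarrow>
      \<sigma> = (\<chi> j. ln (norm (1 + \<zeta> * of_real (d $ j))) - d $ j * Re \<zeta>) \<Longrightarrow>
      v (z0 + \<zeta> *s (\<chi> j. z0 $ j * of_real (d $ j)))
      \<le> ereal (v0 + A * Re \<zeta> - \<epsilon> * (Re \<zeta>)\<^sup>2 + m * (2 * (y \<bullet> \<sigma>) + \<sigma> \<bullet> \<sigma>))"
  shows False
proof -
  define K where "K = norm d + 1"
  define D4 where "D4 = (\<Sum>j\<in>UNIV. (d $ j) ^ 4)"
  \<comment> \<open>The bound \<open>1 / (2 * K)\<close> keeps the logarithms within range of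
    \<open>Ln_approx_linear\<close>. The last bound yields
    \<open>8 * m * D4 * r\<^sup>2 < \<epsilon>\<close>, which contradicts the final comparison of
    means; its summand 1 keeps the denominator positive.\<close>
  define r where "r = min \<delta> (min (1 / (2 * K)) (\<epsilon> / (8 * m * D4 + 1)))"
  have K: "K \<ge> 1" "\<And>j. \<bar>d $ j\<bar> \<le> K"
    using component_le_norm_cart[of d] by (auto simp: K_def add_increasing2)
  have D4: "D4 \<ge> 0"
    unfolding D4_def by (intro sum_nonneg) auto
  have mD4: "8 * m * D4 \<ge> 0"
    using D4 \<open>m \<ge> 0\<close> by simp
  have r: "r > 0" "r \<le> \<delta>" "r \<le> 1 / (2 * K)" "r \<le> \<epsilon> / (8 * m * D4 + 1)"
    using K(1) mD4 assms(3,4) unfolding r_def by (auto intro!: divide_pos_pos add_nonneg_pos)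
  have r1: "r \<le> 1"
  proof -
    have "1 / (2 * K) \<le> 1"
      using K(1) by (simp add: field_simps)
    then show ?thesis using r(3) by linarith
  qed
  have rd: "norm (of_real r * cis t * of_real (d $ j)) \<le> 1 / 2" for t j
  proof -
    have "r * \<bar>d $ j\<bar> \<le> 1 / (2 * K) * K"
      using r K by (intro mult_mono) auto
    then show ?thesis
      using r K(1) by (simp add: norm_mult abs_mult)
  qed
  have small: "8 * m * D4 * r\<^sup>2 < \<epsilon>"
  proof -
    have "r * (8 * m * D4 + 1) \<le> \<epsilon>"
      using r(4) mD4 by (simp add: pos_le_divide_eq)
    then have "8 * m * D4 * r < \<epsilon>"
      using r(1) by (simp add: algebra_simps)
    moreover have "8 * m * D4 * r\<^sup>2 \<le> 8 * m * D4 * r"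
      using r1 r(1) mD4 by (intro mult_left_mono) (auto simp: power2_eq_square)
    ultimately show ?thesis by linarith
  qed
  \<comment> \<open>\<open>g j\<close> is the j-th coordinate of the logarithmic error \<sigma> on
    the circle. Its square is at most \<open>4 * r ^ 4 * (d $ j) ^ 4\<close>, so C dominates the
    quadratic part of the penalty, while the part linear in \<sigma> is kept exactly in
    \<open>h\<close> because its mean vanishes.\<close>
  define C where "C = m * (4 * r ^ 4 * D4)"
  define g where "g j t = ln (norm (1 + of_real r * of_real (d $ j) * cis t)) - d $ j * r * cos t"
    for j t
  define h where "h t = v0 + A * r * cos t - \<epsilon> * r\<^sup>2 * (cos t)\<^sup>2 + (\<Sum>j\<in>UNIV. 2 * m * y $ j * g j t) + C"
    for t
  have sq: "(g j t)\<^sup>2 \<le> 4 * r ^ 4 * (d $ j) ^ 4" for j t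
  proof -
    define w where "w = of_real r * of_real (d $ j) * cis t"
    have w: "norm w \<le> 1 / 2" "norm w = r * \<bar>d $ j\<bar>"
      using rd[of t j] r(1) by (simp_all add: w_def norm_mult mult_ac)
    have "Re (Ln (1 + w) - w) = g j t"
    proof -
      have "1 + w \<noteq> 0"
      proof
        assume "1 + w = 0"
        then have "norm w = 1"
          by (metis add_eq_0_iff norm_minus_cancel norm_one)
        then show False using w(1) by simp
      qed
      then show ?thesis
        by (simp add: g_def w_def mult_ac)
    qed
    then have "\<bar>g j t\<bar> \<le> norm (Ln (1 + w) - w)"
      by (metis abs_Re_le_cmod)
    also have "\<dots> \<le> (norm w)\<^sup>2 / (1 - norm w)"
      using w(1) by (intro Ln_approx_linear) auto
    also have "\<dots> \<le> (norm w)\<^sup>2 / (1 / 2)"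
      using w(1) by (intro divide_left_mono) auto
    finally have "\<bar>g j t\<bar> \<le> 2 * (r * \<bar>d $ j\<bar>)\<^sup>2"
      by (simp add: w(2))
    then have "\<bar>g j t\<bar>\<^sup>2 \<le> (2 * (r * \<bar>d $ j\<bar>)\<^sup>2)\<^sup>2"
      by (intro power_mono) auto
    then show ?thesis
      by (simp add: power_mult_distrib flip: power_mult)
  qed
  have "v (z0 + 0 *s (\<chi> j. z0 $ j * of_real (d $ j)))
      \<le> circle_mean (\<lambda>\<zeta>. v (z0 + \<zeta> *s (\<chi> j. z0 $ j * of_real (d $ j)))) 0 r"
    using r D by (intro psh_line_submean[OF psh]) auto
  \<comment> \<open>\<open>circle_mean\<close> takes a function of the point, whereas
    \<open>h\<close> is a function of the angle; since \<open>h\<close> depends on t only through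
    \<open>cis t\<close>, composing with \<open>Arg2pi\<close> does no harm.\<close>
  also have "\<dots> \<le> circle_mean (\<lambda>\<zeta>. ereal (h (Arg2pi \<zeta>))) 0 r"
  proof (rule circle_mean_mono)
    fix t :: real
    let ?\<zeta> = "0 + of_real r * cis t"
    have cis: "cis (Arg2pi ?\<zeta>) = cis t"
    proof -
      have "of_real (norm ?\<zeta>) * cis (Arg2pi ?\<zeta>) = ?\<zeta>"
        using Arg2pi_eq[of ?\<zeta>] by (simp add: cis_conv_exp)
      then show ?thesis using r(1) by (simp add: norm_mult)
    qed
    then have cos: "cos (Arg2pi ?\<zeta>) = cos t"
      by (metis cis.sel(1))
    have h: "h (Arg2pi ?\<zeta>) = h t"
      unfolding h_def g_def cos cis ..
    define \<sigma> where "\<sigma> = (\<chi> j. ln (norm (1 + ?\<zeta> * of_real (d $ j))) - d $ j * Re ?\<zeta>)"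
    have \<sigma>: "\<sigma> $ j = g j t" for j
      unfolding \<sigma>_def g_def by (simp add: mult_ac)
    have "v (z0 + ?\<zeta> *s (\<chi> j. z0 $ j * of_real (d $ j)))
        \<le> ereal (v0 + A * Re ?\<zeta> - \<epsilon> * (Re ?\<zeta>)\<^sup>2 + m * (2 * (y \<bullet> \<sigma>) + \<sigma> \<bullet> \<sigma>))"
    proof (rule touch[OF _ _ \<sigma>_def])
      show "norm ?\<zeta> \<le> \<delta>" using r by (simp add: norm_mult)
      show "norm (?\<zeta> * of_real (d $ j)) \<le> 1 / 2" for j using rd[of t j] by simp
    qed
    also have "\<dots> \<le> ereal (h t)"
    proof -
      have "\<sigma> \<bullet> \<sigma> = (\<Sum>j\<in>UNIV. (g j t)\<^sup>2)"
        by (simp add: inner_vec_def \<sigma> power2_eq_square)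
      also have "\<dots> \<le> (\<Sum>j\<in>UNIV. 4 * r ^ 4 * (d $ j) ^ 4)"
        by (intro sum_mono sq)
      finally have "m * (\<sigma> \<bullet> \<sigma>) \<le> C"
        unfolding C_def D4_def using \<open>m \<ge> 0\<close> by (intro mult_left_mono) (auto simp: sum_distrib_left)
      moreover have "m * (2 * (y \<bullet> \<sigma>)) = (\<Sum>j\<in>UNIV. 2 * m * y $ j * g j t)"
        by (simp add: inner_vec_def \<sigma> sum_distrib_left mult_ac)
      ultimately show ?thesis
        unfolding h_def by (simp add: algebra_simps power_mult_distrib)
    qed
    finally show "v (z0 + ?\<zeta> *s (\<chi> j. z0 $ j * of_real (d $ j))) \<le> ereal (h (Arg2pi ?\<zeta>))"
      by (simp only: h)
  qed
  \<comment> \<open>The cosine and all \<open>g j\<close> integrate to 0 over a period; only the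
    constants and the squared cosine survive.\<close>
  also have "\<dots> = ereal ((2 * pi * v0 - \<epsilon> * r\<^sup>2 * pi + 2 * pi * C) / (2 * pi))"
  proof (rule circle_mean_of_has_integral)
    have wlt: "norm (of_real r * of_real (d $ j) :: complex) < 1" for j
      using rd[of 0 j] by (simp add: norm_mult)
    have g0: "(g j has_integral 0 - d $ j * r * 0) {0..2*pi}" for j
      unfolding g_def
      by (intro has_integral_diff has_integral_mult_right has_integral_cos_period
          has_integral_ln_norm_one_plus_circle wlt)
    have "(h has_integral (2 * pi * v0 + A * r * 0 - \<epsilon> * r\<^sup>2 * pi
        + (\<Sum>j\<in>UNIV. 2 * m * y $ j * (0 - d $ j * r * 0)) + 2 * pi * C)) {0..2*pi}"
      unfolding h_def
      by (intro has_integral_add has_integral_diff has_integral_mult_right has_integral_cos_period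
          has_integral_cos_sq_period has_integral_sum g0)
        (use has_integral_const_real[of v0 0 "2*pi"] has_integral_const_real[of C 0 "2*pi"] in auto)
    then show "(h has_integral 2 * pi * v0 - \<epsilon> * r\<^sup>2 * pi + 2 * pi * C) {0..2*pi}"
      by simp
    have nz: "1 + of_real r * of_real (d $ j) * cis t \<noteq> 0" for j t
    proof
      assume "1 + of_real r * of_real (d $ j) * cis t = 0"
      then have "norm (of_real r * of_real (d $ j) * cis t) = 1"
        by (metis add_eq_0_iff norm_minus_cancel norm_one)
      then show False using wlt[of j] by (simp add: norm_mult)
    qed
    show "continuous_on UNIV h"
      unfolding h_def g_def
      using nz by (intro continuous_intros continuous_on_compose2[OF continuous_on_cis]) auto
    fix t :: real
    have "of_real (norm (of_real r * cis t)) * cis (Arg2pi (of_real r * cis t)) = of_real r * cis t"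
      using Arg2pi_eq[of "of_real r * cis t"] by (simp add: cis_conv_exp)
    then have cis: "cis (Arg2pi (of_real r * cis t)) = cis t"
      using r(1) by (simp add: norm_mult)
    then have cos: "cos (Arg2pi (of_real r * cis t)) = cos t"
      by (metis cis.sel(1))
    show "ereal (h (Arg2pi (0 + of_real r * cis t))) = ereal (h t)"
      unfolding h_def g_def add_0 cos cis ..
  qed
  finally have "v0 \<le> (2 * pi * v0 - \<epsilon> * r\<^sup>2 * pi + 2 * pi * C) / (2 * pi)"
    by (simp add: v0)
  then have "\<epsilon> * r\<^sup>2 \<le> 2 * C"
    by (simp add: field_simps)
  then have "\<epsilon> * r\<^sup>2 \<le> (8 * m * D4 * r\<^sup>2) * r\<^sup>2"
    by (simp add: C_def power4_eq_xxxx power2_eq_square mult_ac)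
  then have "\<epsilon> \<le> 8 * m * D4 * r\<^sup>2"
    using r(1) by simp
  then show False using small by linarith
qed

text \<open>The strict sublevel set is open by semicontinuity and contains a compact torus of
  angles, so the tube lemma gives one radius for all angles.\<close>

lemma psh_torus_bound_nearby:
  fixes v :: "complex ^ 'n \<Rightarrow> ereal"
  assumes psh: "psh_on v unit_polydisk" and b: "b \<in> neg_orthant"
    and bd: "\<And>\<theta>. v (torus_point b \<theta>) < a"
  shows "\<exists>\<rho>>0. \<forall>y \<theta>. norm y \<le> \<rho> \<longrightarrow> \<theta> \<in> cbox 0 (\<chi> j. 2 * pi) \<longrightarrow> v (torus_point (b + y) \<theta>) < a"
proof -
  let ?O = "{x :: (real ^ 'n) \<times> (real ^ 'n). b + fst x \<in> neg_orthant}"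
  let ?W = "{x \<in> ?O. v (torus_point (b + fst x) (snd x)) < a}"
  have O: "open ?O"
  proof -
    have "open ((\<lambda>x :: (real ^ 'n) \<times> (real ^ 'n). b + fst x) -` neg_orthant)"
      by (intro open_vimage open_neg_orthant continuous_intros)
    then show ?thesis by (simp add: vimage_def)
  qed
  have "usc_on (\<lambda>x. v (torus_point (b + fst x) (snd x))) ?O"
  proof (rule usc_on_compose[of v unit_polydisk])
    show "usc_on v unit_polydisk" using psh by (simp add: psh_on_def)
    show "continuous_on ?O (\<lambda>x. torus_point (b + fst x) (snd x))"
      by (intro continuous_intros)
  qed (use O open_unit_polydisk torus_point_mem_unit_polydisk in auto)
  then have "open ?W"
    by (rule open_usc_sublevel[OF _ O])
  moreover have "{0} \<times> cbox 0 (\<chi> j. 2 * pi) \<subseteq> ?W"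
    using bd b by auto
  ultimately obtain X0 where X0: "0 \<in> X0" "open X0" "X0 \<times> cbox 0 (\<chi> j. 2 * pi) \<subseteq> ?W"
    using Elementary_Topology.tube_lemma[of "cbox 0 (\<chi> j. 2 * pi)" ?W 0] compact_cbox by blast
  then obtain \<rho> where "\<rho> > 0" "cball 0 \<rho> \<subseteq> X0"
    using open_contains_cball by blast
  then show ?thesis
    using X0(3) by (intro exI[of _ \<rho>]) (auto simp: subset_iff)
qed

lemma neg_orthant_segment_nbhd:
  fixes p q :: "real ^ 'n"
  assumes "p \<in> neg_orthant" "q \<in> neg_orthant"
  shows "\<exists>\<rho>>0. \<forall>s y. 0 \<le> s \<longrightarrow> s \<le> 1 \<longrightarrow> norm y \<le> \<rho> \<longrightarrow> p + s *\<^sub>R (q - p) + y \<in> neg_orthant"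
proof -
  let ?F = "range (\<lambda>j. min (- p $ j) (- q $ j))"
  \<comment> \<open>Every coordinate of p and q, hence of each point of the segment, is at most
    \<open>- 2 * \<mu>\<close>, which leaves room for a perturbation of norm \<mu>.\<close>
  define \<mu> where "\<mu> = Min ?F / 2"
  have "Min ?F \<in> ?F"
    by (intro Min_in) auto
  then have "\<mu> > 0"
    using assms by (auto simp: \<mu>_def neg_orthant_def)
  moreover have "p + s *\<^sub>R (q - p) + y \<in> neg_orthant"
    if s: "0 \<le> s" "s \<le> 1" and y: "norm y \<le> \<mu>" for s y
    unfolding neg_orthant_def
  proof safe
    fix j
    have m: "2 * \<mu> \<le> min (- p $ j) (- q $ j)"
      unfolding \<mu>_def using Min_le[of ?F "min (- p $ j) (- q $ j)"] by simp
    have "(1 - s) * (p $ j) + s * (q $ j) \<le> (1 - s) * (- 2 * \<mu>) + s * (- 2 * \<mu>)"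
      using m s by (intro add_mono mult_left_mono) auto
    moreover have "(1 - s) * (- 2 * \<mu>) + s * (- 2 * \<mu>) = - 2 * \<mu>"
      by (simp add: algebra_simps)
    moreover have "y $ j \<le> \<mu>"
      using component_le_norm_cart[of y j] y by linarith
    ultimately show "(p + s *\<^sub>R (q - p) + y) $ j < 0"
      using \<open>\<mu> > 0\<close> by (simp add: algebra_simps)
  qed
  ultimately show ?thesis by blast
qed

text \<open>The penalty \<open>m \<parallel>y\<parallel>\<^sup>2\<close> keeps the
  maximum close to the segment from \<open>p\<close> to \<open>q\<close>, and \<open>\<gamma> s (1 - s)\<close> makes the comparison function
  strictly concave along it.\<close>

lemma psh_torus_convex:
  fixes v :: "complex ^ 'n \<Rightarrow> ereal" and p q :: "real ^ 'n"
  assumes psh: "psh_on v unit_polydisk" and neg: "\<And>z. z \<in> unit_polydisk \<Longrightarrow> v z \<le> 0"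
    and p: "p \<in> neg_orthant" and q: "q \<in> neg_orthant"
    and vp: "\<And>\<theta>. v (torus_point p \<theta>) \<le> ereal \<alpha>"
    and vq: "\<And>\<theta>. v (torus_point q \<theta>) \<le> ereal \<beta>"
    and t: "0 \<le> t" "t \<le> 1"
  shows "v (torus_point (p + t *\<^sub>R (q - p)) \<phi>) \<le> ereal ((1 - t) * \<alpha> + t * \<beta>)"
proof (rule ccontr)
  define d where "d = q - p"
  define l where "l s = \<alpha> + (\<beta> - \<alpha>) * s" for s
  let ?box = "cbox 0 (\<chi> j. 2 * pi) :: (real ^ 'n) set"
  assume "\<not> ?thesis"
  then have gt: "ereal (l t) < v (torus_point (p + t *\<^sub>R d) \<phi>)"
    by (simp add: l_def d_def algebra_simps not_le)
  have pd: "p + t *\<^sub>R d \<in> neg_orthant"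
    using neg_orthant_segment_nbhd[OF p q] t unfolding d_def
    by (metis add.right_neutral norm_zero less_imp_le)
  obtain \<phi>' where \<phi>': "\<phi>' \<in> ?box" "torus_point (p + t *\<^sub>R d) \<phi> = torus_point (p + t *\<^sub>R d) \<phi>'"
    using ex_torus_point[of "torus_point (p + t *\<^sub>R d) \<phi>" "p + t *\<^sub>R d"] by auto
  define z where "z = torus_point (p + t *\<^sub>R d) \<phi>'"
  have "v z \<le> 0"
    unfolding z_def by (intro neg torus_point_mem_unit_polydisk pd)
  then obtain \<kappa> where \<kappa>: "v z = ereal \<kappa>" "l t < \<kappa>"
    using gt \<phi>'(2) by (cases "v z") (auto simp: z_def)
  \<comment> \<open>Half of the excess over the chord: since \<open>t * (1 - t) \<le> 1\<close>, the
    concave perturbation uses up at most one half, and the difference to be maximized is still at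
    least \<gamma> at the violating point.\<close>
  define \<gamma> where "\<gamma> = (\<kappa> - l t) / 2"
  have "\<gamma> > 0" using \<kappa>(2) by (simp add: \<gamma>_def)
  obtain \<rho>0 where \<rho>0: "\<rho>0 > 0" "\<And>s y. 0 \<le> s \<Longrightarrow> s \<le> 1 \<Longrightarrow> norm y \<le> \<rho>0 \<Longrightarrow> p + s *\<^sub>R d + y \<in> neg_orthant"
    using neg_orthant_segment_nbhd[OF p q] unfolding d_def by blast
  have "v (torus_point p \<theta>) < ereal (\<alpha> + \<gamma>)" for \<theta>
    using vp[of \<theta>] \<open>\<gamma> > 0\<close> by (rule_tac le_less_trans) auto
  from psh_torus_bound_nearby[OF psh p this] obtain \<rho>1 where \<rho>1: "\<rho>1 > 0"
    "\<And>y \<theta>. norm y \<le> \<rho>1 \<Longrightarrow> \<theta> \<in> ?box \<Longrightarrow> v (torus_point (p + y) \<theta>) < ereal (\<alpha> + \<gamma>)"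
    by blast
  have "v (torus_point q \<theta>) < ereal (\<beta> + \<gamma>)" for \<theta>
    using vq[of \<theta>] \<open>\<gamma> > 0\<close> by (rule_tac le_less_trans) auto
  from psh_torus_bound_nearby[OF psh q this] obtain \<rho>2 where \<rho>2: "\<rho>2 > 0"
    "\<And>y \<theta>. norm y \<le> \<rho>2 \<Longrightarrow> \<theta> \<in> ?box \<Longrightarrow> v (torus_point (q + y) \<theta>) < ereal (\<beta> + \<gamma>)"
    by blast
  define \<rho> where "\<rho> = min \<rho>0 (min \<rho>1 \<rho>2)"
  have \<rho>: "\<rho> > 0" "\<rho> \<le> \<rho>0" "\<rho> \<le> \<rho>1" "\<rho> \<le> \<rho>2"
    using \<rho>0(1) \<rho>1(1) \<rho>2(1) by (auto simp: \<rho>_def)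
  \<comment> \<open>On \<open>norm y = \<rho>\<close> the penalty then outweighs the most negative
    value of the chord, so \<open>h\<close> is nonnegative there, while v is at most 0.\<close>
  define m where "m = (\<bar>\<alpha>\<bar> + \<bar>\<beta>\<bar>) / \<rho>\<^sup>2"
  have m: "m \<ge> 0" "m * \<rho>\<^sup>2 = \<bar>\<alpha>\<bar> + \<bar>\<beta>\<bar>"
    using \<rho>(1) by (auto simp: m_def)
  define h where "h s y = l s + \<gamma> * (s * (1 - s)) + m * (y \<bullet> y)" for s and y :: "real ^ 'n"
  define K where "K = ({0..1} :: real set) \<times> (cball 0 \<rho> :: (real ^ 'n) set) \<times> ?box"
  define V where "V = {x :: real \<times> (real ^ 'n) \<times> (real ^ 'n). p + fst x *\<^sub>R d + fst (snd x) \<in> neg_orthant}"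
  define f where "f x = v (torus_point (p + fst x *\<^sub>R d + fst (snd x)) (snd (snd x)))" for x
  have V: "open V"
  proof -
    have "open ((\<lambda>x :: real \<times> (real ^ 'n) \<times> (real ^ 'n). p + fst x *\<^sub>R d + fst (snd x)) -` neg_orthant)"
      by (intro open_vimage open_neg_orthant continuous_intros)
    then show ?thesis by (simp add: vimage_def V_def)
  qed
  have mem: "torus_point (p + fst x *\<^sub>R d + fst (snd x)) (snd (snd x)) \<in> unit_polydisk" if "x \<in> V" for x
    using that unfolding V_def by (intro torus_point_mem_unit_polydisk) auto
  have uf: "usc_on f V"
    unfolding f_def
  proof (rule usc_on_compose[of v unit_polydisk])
    show "usc_on v unit_polydisk" using psh by (simp add: psh_on_def)
    show "continuous_on V (\<lambda>x. torus_point (p + fst x *\<^sub>R d + fst (snd x)) (snd (snd x)))"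
      by (intro continuous_intros)
  qed (use V open_unit_polydisk mem in auto)
  have ug: "usc_on (\<lambda>x. f x + ereal (- h (fst x) (fst (snd x)))) V"
  proof (rule usc_on_add_continuous[OF uf V])
    show "continuous_on V (\<lambda>x. - h (fst x) (fst (snd x)))"
      unfolding h_def l_def by (intro continuous_intros)
    show "f x < \<infinity>" if "x \<in> V" for x
      using neg[OF mem[OF that]] unfolding f_def by auto
  qed
  have x0: "(t, 0, \<phi>') \<in> K"
    using t \<rho>(1) \<phi>'(1) by (auto simp: K_def)
  have KV: "K \<subseteq> V"
    using \<rho>0(2) \<rho> unfolding K_def V_def by auto
  have "compact K"
    unfolding K_def by (intro compact_Times compact_cbox compact_cball compact_Icc)
  then obtain x where x: "x \<in> K"
    and xmax: "\<And>x'. x' \<in> K \<Longrightarrow> f x' + ereal (- h (fst x') (fst (snd x'))) \<le> f x + ereal (- h (fst x) (fst (snd x)))"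
    using usc_attains_sup[OF ug V _ _ KV] x0 by blast
  obtain s y \<theta> where xe: "x = (s, y, \<theta>)"
    by (cases x) auto
  have sy: "0 \<le> s" "s \<le> 1" "norm y \<le> \<rho>" "\<theta> \<in> ?box"
    using x by (auto simp: xe K_def)
  define z0 where "z0 = torus_point (p + s *\<^sub>R d + y) \<theta>"
  have fx: "f x = v z0"
    by (simp add: f_def xe z0_def)
  have "f x \<le> 0"
    unfolding f_def using KV x by (intro neg mem) auto
  have "f (t, 0, \<phi>') = ereal \<kappa>"
    by (simp add: f_def \<kappa>(1) flip: z_def)
  then have "ereal (\<kappa> - h t 0) \<le> f x + ereal (- h s y)"
    using xmax[OF x0] by (simp add: xe)
  moreover have "\<gamma> \<le> \<kappa> - h t 0"
  proof -
    have "t * (1 - t) \<le> 1"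
      using t by (simp add: mult_le_one)
    then have "\<gamma> * (t * (1 - t)) \<le> \<gamma>"
      using \<open>\<gamma> > 0\<close> by (simp add: mult_left_le)
    then show ?thesis
      unfolding h_def \<gamma>_def by (simp add: field_simps)
  qed
  ultimately have *: "ereal \<gamma> \<le> f x + ereal (- h s y)"
    by (meson ereal_less_eq(3) order_trans)
  then obtain v0 where v0: "f x = ereal v0" "v0 \<ge> h s y + \<gamma>" "v0 \<le> 0"
    using \<open>f x \<le> 0\<close> by (cases "f x") auto
  \<comment> \<open>The maximum of the difference is at least \<gamma>, but near both end tori v
    stays strictly less than \<gamma> above the chord. This excludes both ends of the segment, and
    the choice of m excludes the sphere \<open>norm y = \<rho>\<close>.\<close>
  have s0: "s \<noteq> 0"
  proof
    assume "s = 0"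
    then have "f x < ereal (\<alpha> + \<gamma>)"
      using \<rho>1(2)[of y \<theta>] sy \<rho> by (simp add: fx z0_def)
    moreover have "\<alpha> \<le> h s y"
      using m(1) \<open>s = 0\<close> by (simp add: h_def l_def)
    ultimately show False
      using v0 by simp
  qed
  have s1: "s \<noteq> 1"
  proof
    assume "s = 1"
    then have "f x < ereal (\<beta> + \<gamma>)"
      using \<rho>2(2)[of y \<theta>] sy \<rho> by (simp add: fx z0_def d_def)
    moreover have "\<beta> \<le> h s y"
      using m(1) \<open>s = 1\<close> by (simp add: h_def l_def)
    ultimately show False
      using v0 by simp
  qed
  have y1: "norm y \<noteq> \<rho>"
  proof
    assume "norm y = \<rho>"
    then have "m * (y \<bullet> y) = \<bar>\<alpha>\<bar> + \<bar>\<beta>\<bar>"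
      using m(2) by (simp add: dot_square_norm)
    moreover have "l s \<ge> - (\<bar>\<alpha>\<bar> + \<bar>\<beta>\<bar>)"
    proof -
      have "(1 - s) * \<alpha> \<ge> (1 - s) * (- (\<bar>\<alpha>\<bar> + \<bar>\<beta>\<bar>))" "s * \<beta> \<ge> s * (- (\<bar>\<alpha>\<bar> + \<bar>\<beta>\<bar>))"
        using sy by (auto intro!: mult_left_mono simp del: mult_minus_right)
      then show ?thesis
        by (simp add: l_def algebra_simps)
    qed
    moreover have "\<gamma> * (s * (1 - s)) \<ge> 0"
      using sy \<open>\<gamma> > 0\<close> by simp
    ultimately have "h s y \<ge> 0"
      by (simp add: h_def)
    then show False
      using v0 \<open>\<gamma> > 0\<close> by linarith
  qed
  define \<delta>1 where "\<delta>1 = min s (min (1 - s) 1)"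
  have \<delta>1: "\<delta>1 > 0" using sy s0 s1 by (auto simp: \<delta>1_def)
  define D where "D = (\<Sum>j\<in>UNIV. 2 * (d $ j)\<^sup>2)"
  have "D \<ge> 0" unfolding D_def by (intro sum_nonneg) auto
  \<comment> \<open>The three bounds keep the parameter in [0,1], the displacement
    \<open>y + \<sigma>\<close> in the ball of radius \<rho>, and the logarithmic expansion
    valid.\<close>
  define \<delta> where "\<delta> = min \<delta>1 (min ((\<rho> - norm y) / (D + 1)) (1 / (2 * (norm d + 1))))"
  have \<delta>: "\<delta> > 0" "\<delta> \<le> \<delta>1" "\<delta> \<le> (\<rho> - norm y) / (D + 1)" "\<delta> \<le> 1 / (2 * (norm d + 1))"
    using \<delta>1 sy y1 \<open>D \<ge> 0\<close> unfolding \<delta>_def by (auto intro!: divide_pos_pos add_nonneg_pos)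
  \<comment> \<open>The slope at s of the chord plus the concave term. Moving by \<zeta> along the
    complex line replaces \<open>(s, y)\<close> by \<open>(s + Re \<zeta>, y + \<sigma>)\<close>, so
    maximality at x bounds v by the exact increment of \<open>h\<close>.\<close>
  define A where "A = \<beta> - \<alpha> + \<gamma> * (1 - 2 * s)"
  have main: "z0 + \<zeta> *s (\<chi> j. z0 $ j * of_real (d $ j)) \<in> unit_polydisk \<and>
      v (z0 + \<zeta> *s (\<chi> j. z0 $ j * of_real (d $ j)))
      \<le> ereal (v0 + A * Re \<zeta> - \<gamma> * (Re \<zeta>)\<^sup>2 + m * (2 * (y \<bullet> \<sigma>) + \<sigma> \<bullet> \<sigma>))"
    if \<zeta>: "norm \<zeta> \<le> \<delta>" and \<sigma>: "\<sigma> = (\<chi> j. ln (norm (1 + \<zeta> * of_real (d $ j))) - d $ j * Re \<zeta>)" for \<zeta> \<sigma>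
  proof -
    have dj: "norm (\<zeta> * of_real (d $ j)) \<le> 1 / 2" for j
    proof -
      have "norm \<zeta> * \<bar>d $ j\<bar> \<le> 1 / (2 * (norm d + 1)) * (norm d + 1)"
        using \<zeta> \<delta>(4) component_le_norm_cart[of d j] by (intro mult_mono) auto
      also have "\<dots> = 1 / 2"
        using norm_ge_zero[of d] by (simp add: field_simps add_nonneg_eq_0_iff)
      finally show ?thesis by (simp add: norm_mult)
    qed
    have nz: "1 + \<zeta> * of_real (d $ j) \<noteq> 0" for j
    proof
      assume "1 + \<zeta> * of_real (d $ j) = 0"
      then have "norm (\<zeta> * of_real (d $ j)) = 1"
        by (metis add_eq_0_iff norm_minus_cancel norm_one)
      then show False using dj[of j] by simp
    qed
    have \<zeta>1: "norm \<zeta> \<le> \<delta>1" "norm \<zeta> \<le> 1"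
      using \<zeta> \<delta>(2) by (auto simp: \<delta>1_def)
    have sj: "\<bar>\<sigma> $ j\<bar> \<le> norm \<zeta> * (2 * (d $ j)\<^sup>2)" for j
    proof -
      let ?w = "\<zeta> * of_real (d $ j)"
      have "Re (Ln (1 + ?w) - ?w) = \<sigma> $ j"
        using nz[of j] by (simp add: \<sigma>)
      then have "\<bar>\<sigma> $ j\<bar> \<le> norm (Ln (1 + ?w) - ?w)"
        by (metis abs_Re_le_cmod)
      also have "\<dots> \<le> (norm ?w)\<^sup>2 / (1 - norm ?w)"
        using dj[of j] by (intro Ln_approx_linear) auto
      also have "\<dots> \<le> (norm ?w)\<^sup>2 / (1 / 2)"
        using dj[of j] by (intro divide_left_mono) auto
      also have "\<dots> = (norm \<zeta>)\<^sup>2 * (2 * (d $ j)\<^sup>2)"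
        by (simp add: norm_mult power_mult_distrib)
      also have "\<dots> \<le> norm \<zeta> * (2 * (d $ j)\<^sup>2)"
        using \<zeta>1(2) by (intro mult_right_mono) (auto simp: power2_eq_square mult_left_le)
      finally show ?thesis .
    qed
    have "norm \<sigma> \<le> (\<Sum>j\<in>UNIV. \<bar>\<sigma> $ j\<bar>)"
      by (rule norm_le_l1_cart)
    also have "\<dots> \<le> norm \<zeta> * D"
      unfolding D_def sum_distrib_left by (intro sum_mono sj)
    also have "\<dots> \<le> \<delta> * (D + 1)"
      using \<zeta> \<delta>(1) \<open>D \<ge> 0\<close> by (intro mult_mono) auto
    also have "\<dots> \<le> \<rho> - norm y"
      using \<delta>(3) \<open>D \<ge> 0\<close> by (simp add: pos_le_divide_eq)
    finally have y': "norm (y + \<sigma>) \<le> \<rho>"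
      using norm_triangle_ineq[of y \<sigma>] by linarith
    have "\<bar>Re \<zeta>\<bar> \<le> \<delta>1"
      using abs_Re_le_cmod[of \<zeta>] \<zeta>1(1) by linarith
    then have s': "0 \<le> s + Re \<zeta>" "s + Re \<zeta> \<le> 1"
      by (auto simp: \<delta>1_def)
    let ?z = "z0 + \<zeta> *s (\<chi> j. z0 $ j * of_real (d $ j))"
    let ?b = "p + (s + Re \<zeta>) *\<^sub>R d + (y + \<sigma>)"
    have "norm (?z $ j) = exp (?b $ j)" for j
    proof -
      have "?z $ j = z0 $ j * (1 + \<zeta> * of_real (d $ j))"
        by (simp add: algebra_simps)
      then have "norm (?z $ j) = exp ((p + s *\<^sub>R d + y) $ j) * exp (ln (norm (1 + \<zeta> * of_real (d $ j))))"
        using nz[of j] by (simp add: norm_mult z0_def)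
      also have "\<dots> = exp (?b $ j)"
        unfolding exp_add[symmetric] by (simp add: \<sigma> algebra_simps)
      finally show ?thesis .
    qed
    then obtain \<theta>' where \<theta>': "\<theta>' \<in> ?box" "?z = torus_point ?b \<theta>'"
      using ex_torus_point by blast
    have xK: "(s + Re \<zeta>, y + \<sigma>, \<theta>') \<in> K"
      using s' y' \<theta>'(1) by (auto simp: K_def)
    have fz: "f (s + Re \<zeta>, y + \<sigma>, \<theta>') = v ?z"
      by (simp add: f_def \<theta>'(2))
    have "v ?z + ereal (- h (s + Re \<zeta>) (y + \<sigma>)) \<le> ereal (v0 - h s y)"
      using xmax[OF xK] unfolding fz v0(1) by (simp add: xe)
    then have "v ?z \<le> ereal (v0 + (h (s + Re \<zeta>) (y + \<sigma>) - h s y))"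
      by (cases "v ?z") auto
    also have "h (s + Re \<zeta>) (y + \<sigma>) - h s y
        = A * Re \<zeta> - \<gamma> * (Re \<zeta>)\<^sup>2 + m * (2 * (y \<bullet> \<sigma>) + \<sigma> \<bullet> \<sigma>)"
      unfolding h_def l_def A_def
      by (simp add: inner_add_left inner_add_right inner_commute power2_eq_square algebra_simps)
    finally have "v ?z \<le> ereal (v0 + A * Re \<zeta> - \<gamma> * (Re \<zeta>)\<^sup>2 + m * (2 * (y \<bullet> \<sigma>) + \<sigma> \<bullet> \<sigma>))"
      by (simp add: algebra_simps)
    moreover have "?z \<in> unit_polydisk"
      unfolding \<theta>'(2) using xK KV by (intro torus_point_mem_unit_polydisk) (auto simp: V_def)
    ultimately show ?thesis by blast
  qed
  show False
  proof (rule psh_no_concave_touching[OF psh _ \<delta>(1) \<open>\<gamma> > 0\<close> m(1), where y = y and A = A])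
    show "v z0 = ereal v0"
      using v0(1) fx by simp
    show "z0 + \<zeta> *s (\<chi> j. z0 $ j * of_real (d $ j)) \<in> unit_polydisk" if "norm \<zeta> \<le> \<delta>" for \<zeta>
      using main[OF that refl] by blast
  next
    fix \<zeta> \<sigma> assume "norm \<zeta> \<le> \<delta>" "\<sigma> = (\<chi> j. ln (norm (1 + \<zeta> * of_real (d $ j))) - d $ j * Re \<zeta>)"
    from main[OF this] show "v (z0 + \<zeta> *s (\<chi> j. z0 $ j * of_real (d $ j)))
      \<le> ereal (v0 + A * Re \<zeta> - \<gamma> * (Re \<zeta>)\<^sup>2 + m * (2 * (y \<bullet> \<sigma>) + \<sigma> \<bullet> \<sigma>))" by blast
  qed
qed

section \<open>Toric plurisubharmonic functions\<close>

lemma ln_max_circle_submean_less: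
  fixes A B :: complex
  assumes "s > 0" "norm B < norm A"
  shows "2 * pi * ln (norm A) \<le> integral {0..2*pi} (\<lambda>t. ln (max (norm (A + B * cis t)) s))"
proof -
  have "A \<noteq> 0" using assms(2) by auto
  then have "norm (B / A) < 1"
    using assms(2) by (simp add: norm_divide)
  have nz: "A + B * cis t \<noteq> 0" for t
  proof
    assume "A + B * cis t = 0"
    then have "norm A = norm (B * cis t)"
      by (metis add_eq_0_iff norm_minus_cancel)
    then show False using assms(2) by (simp add: norm_mult)
  qed
  \<comment> \<open>With A dominating, \<open>A + B * cis t\<close> has no zero and the mean of its
    log-modulus is exactly \<open>ln (norm A)\<close>; the truncation only raises the
    integrand.\<close>
  have "((\<lambda>t. ln (norm A) + ln (norm (1 + B / A * cis t))) has_integral (2 * pi * ln (norm A) + 0)) {0..2*pi}"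
    by (intro has_integral_add has_integral_ln_norm_one_plus_circle[OF \<open>norm (B / A) < 1\<close>])
      (use has_integral_const_real[of "ln (norm A)" 0 "2*pi"] in simp)
  moreover have "ln (norm A) + ln (norm (1 + B / A * cis t)) = ln (norm (A + B * cis t))" for t
  proof -
    have e: "A + B * cis t = A * (1 + B / A * cis t)"
      using \<open>A \<noteq> 0\<close> by (simp add: field_simps)
    show ?thesis
      using nz[of t] \<open>A \<noteq> 0\<close> unfolding e by (simp add: norm_mult ln_mult)
  qed
  ultimately have "((\<lambda>t. ln (norm (A + B * cis t))) has_integral (2 * pi * ln (norm A))) {0..2*pi}"
    by simp
  moreover have "(\<lambda>t. ln (max (norm (A + B * cis t)) s)) integrable_on {0..2*pi}"
    using assms(1)
    by (intro integrable_continuous_real continuous_intros continuous_on_compose2[OF continuous_on_cis]) auto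
  then have "((\<lambda>t. ln (max (norm (A + B * cis t)) s)) has_integral
      integral {0..2*pi} (\<lambda>t. ln (max (norm (A + B * cis t)) s))) {0..2*pi}"
    by (rule integrable_integral)
  ultimately show ?thesis
    by (rule has_integral_le) (use nz assms(1) in \<open>auto simp: less_max_iff_disj\<close>)
qed

text \<open>Truncation keeps both arguments at least s, where ln has slope at most 1/s. This
  controls the perturbation of B in the next lemma.\<close>

lemma ln_max_lipschitz:
  fixes x y s :: real
  assumes "s > 0" "x \<ge> 0" "y \<ge> 0"
  shows "ln (max x s) \<le> ln (max y s) + \<bar>x - y\<bar> / s"
proof -
  have pos: "max x s > 0" "max y s > 0"
    using assms by auto
  then have "ln (max x s / max y s) \<le> max x s / max y s - 1"
    by (intro ln_le_minus_one) auto
  also have "\<dots> = (max x s - max y s) / max y s"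
    using assms by (simp add: diff_divide_distrib)
  also have "\<dots> \<le> \<bar>x - y\<bar> / max y s"
    using assms by (intro divide_right_mono) auto
  also have "\<dots> \<le> \<bar>x - y\<bar> / s"
    using assms by (intro divide_left_mono) auto
  finally show ?thesis
    using pos by (simp add: ln_div)
qed

text \<open>When the moduli are equal the affine function may vanish on the circle. Shrinking B by
  the factor \<open>1 - \<eta>\<close> restores the strict case at a cost controlled by the
  Lipschitz bound.\<close>

lemma ln_max_circle_submean_le:
  fixes A B :: complex
  assumes "s > 0" "norm B \<le> norm A" "A \<noteq> 0"
  shows "2 * pi * ln (norm A) \<le> integral {0..2*pi} (\<lambda>t. ln (max (norm (A + B * cis t)) s))"
    (is "_ \<le> integral _ ?f")
proof (rule field_le_epsilon)
  fix e :: real assume "e > 0"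
  \<comment> \<open>Chosen so that the total loss \<open>2 * pi * (\<eta> * norm B / s)\<close> is
    at most e; the added 1 covers \<open>B = 0\<close>.\<close>
  define \<eta> where "\<eta> = min (1/2) (e * s / (2 * pi * (norm B + 1)))"
  have \<eta>: "\<eta> > 0" "\<eta> < 1" "\<eta> \<le> e * s / (2 * pi * (norm B + 1))"
    using \<open>e > 0\<close> assms(1) by (auto simp: \<eta>_def intro!: divide_pos_pos mult_pos_pos add_nonneg_pos)
  let ?g = "\<lambda>t. ln (max (norm (A + of_real (1 - \<eta>) * B * cis t)) s)"
  have "(1 - \<eta>) * norm B < norm A"
  proof (cases "B = 0")
    case False
    then have "(1 - \<eta>) * norm B < 1 * norm B"
      using \<eta> by (intro mult_strict_right_mono) auto
    then show ?thesis using assms(2) by linarith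
  qed (use assms(3) in auto)
  then have "2 * pi * ln (norm A) \<le> integral {0..2*pi} ?g"
    using \<eta> by (intro ln_max_circle_submean_less[OF assms(1)]) (simp add: norm_mult del: of_real_diff)
  also have "\<dots> \<le> integral {0..2*pi} (\<lambda>t. ?f t + \<eta> * norm B / s)"
  proof (rule integral_le)
    show "?g integrable_on {0..2*pi}" "(\<lambda>t. ?f t + \<eta> * norm B / s) integrable_on {0..2*pi}"
      using assms(1)
      by (intro integrable_continuous_real continuous_intros continuous_on_compose2[OF continuous_on_cis]; auto)+
  next
    fix t :: real
    let ?x = "norm (A + of_real (1 - \<eta>) * B * cis t)" and ?y = "norm (A + B * cis t)"
    have "\<bar>?x - ?y\<bar> \<le> norm ((A + of_real (1 - \<eta>) * B * cis t) - (A + B * cis t))"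
      by (rule norm_triangle_ineq3)
    also have "(A + of_real (1 - \<eta>) * B * cis t) - (A + B * cis t) = - (of_real \<eta> * B * cis t)"
      by (simp add: algebra_simps)
    also have "norm \<dots> = \<eta> * norm B"
      using \<eta> by (simp add: norm_mult)
    finally have "\<bar>?x - ?y\<bar> / s \<le> \<eta> * norm B / s"
      using assms(1) by (intro divide_right_mono) auto
    then show "?g t \<le> ?f t + \<eta> * norm B / s"
      using ln_max_lipschitz[OF assms(1), of ?x ?y] by simp
  qed
  also have "\<dots> = integral {0..2*pi} ?f + 2 * pi * (\<eta> * norm B / s)"
  proof -
    have "?f integrable_on {0..2*pi}"
      using assms(1)
      by (intro integrable_continuous_real continuous_intros continuous_on_compose2[OF continuous_on_cis]) auto
    then show ?thesis
      by (subst Henstock_Kurzweil_Integration.integral_add) auto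
  qed
  also have "2 * pi * (\<eta> * norm B / s) \<le> e"
  proof -
    have "\<eta> * norm B \<le> e * s / (2 * pi * (norm B + 1)) * (norm B + 1)"
      using \<eta> by (intro mult_mono) auto
    also have "\<dots> = e * s / (2 * pi)"
      by (simp add: add_nonneg_eq_0_iff)
    finally show ?thesis
      using assms(1) by (simp add: field_simps)
  qed
  finally show "2 * pi * ln (norm A) \<le> integral {0..2*pi} ?f + e"
    by simp
qed

text \<open>If A is below the truncation level, the constant \<open>ln s\<close> is a minorant. If B
  dominates, conjugation exchanges the roles of A and B on the circle, and the mean is at least
  \<open>ln (norm B)\<close>, which exceeds \<open>ln (norm A)\<close>.\<close>

lemma ln_max_circle_submean:
  fixes A B :: complex
  assumes "s > 0"
  shows "2 * pi * ln (max (norm A) s) \<le> integral {0..2*pi} (\<lambda>t. ln (max (norm (A + B * cis t)) s))"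
    (is "_ \<le> integral _ ?f")
proof (cases "norm A \<le> s")
  case True
  have "integral {0..2*pi} (\<lambda>t. ln s) \<le> integral {0..2*pi} ?f"
    using assms
    by (intro integral_le integrable_continuous_real continuous_intros
        continuous_on_compose2[OF continuous_on_cis]) auto
  then show ?thesis using True by (simp add: max_def mult_ac)
next
  case False
  then have A: "A \<noteq> 0" "max (norm A) s = norm A" using assms by auto
  show ?thesis
  proof (cases "norm B \<le> norm A")
    case True
    then show ?thesis using ln_max_circle_submean_le[OF assms True A(1)] A(2) by simp
  next
    case False
    have "norm (A + B * cis t) = norm (cnj B + cnj A * cis t)" for t
    proof -
      have "A + B * cis t = cis t * cnj (cnj B + cnj A * cis t)"
        by (simp add: algebra_simps cis_cnj cis_mult)
      then show ?thesis
        by (simp add: norm_mult complex_mod_cnj del: complex_cnj_add)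
    qed
    then have "2 * pi * ln (norm (cnj B)) \<le> integral {0..2*pi} ?f"
      using ln_max_circle_submean_less[OF assms, of "cnj A" "cnj B"] False by simp
    moreover have "ln (norm A) \<le> ln (norm B)"
      using A False by (subst ln_le_cancel_iff) auto
    then have "2 * pi * ln (norm A) \<le> 2 * pi * ln (norm B)"
      by simp
    ultimately show ?thesis unfolding A(2) complex_mod_cnj by linarith
  qed
qed

section \<open>Support functions and the plurisubharmonic functions they induce\<close>

definition support_fun :: "(real ^ 'n) set \<Rightarrow> real ^ 'n \<Rightarrow> real" where
  "support_fun S b = (SUP c\<in>S. c \<bullet> b)"

definition log_norm :: "complex ^ 'n \<Rightarrow> real ^ 'n" where
  "log_norm z = (\<chi> j. ln (norm (z $ j)))"

definition log_max :: "real \<Rightarrow> complex ^ 'n \<Rightarrow> real ^ 'n" where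
  "log_max s z = (\<chi> j. ln (max (norm (z $ j)) s))"

text \<open>The infimum over truncation levels gives explicit values on the coordinate hyperplanes,
  and exhibits the function as a decreasing limit of continuous ones with the sub-mean value
  property. Levels below 1 keep the argument in the orthant, where \<open>support_fun\<close> is a
  supremum of a bounded set.\<close>

definition toric_psh :: "(real ^ 'n) set \<Rightarrow> complex ^ 'n \<Rightarrow> ereal" where
  "toric_psh S z = (INF s\<in>{0<..<1}. ereal (support_fun S (log_max s z)))"

lemma log_max_mem_neg_orthant:
  "z \<in> unit_polydisk \<Longrightarrow> 0 < s \<Longrightarrow> s < 1 \<Longrightarrow> log_max s z \<in> neg_orthant"
  by (auto simp: log_max_def neg_orthant_def unit_polydisk_def less_max_iff_disj ln_less_zero)

lemma log_norm_mem_neg_orthant: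
  "z \<in> unit_polydisk \<Longrightarrow> (\<And>j. z $ j \<noteq> 0) \<Longrightarrow> log_norm z \<in> neg_orthant"
  by (auto simp: log_norm_def neg_orthant_def unit_polydisk_def)

lemma convex_neg_orthant: "convex (neg_orthant :: (real ^ 'n) set)"
proof -
  have eq: "neg_orthant = (\<Inter>j. {b :: real ^ 'n. axis j 1 \<bullet> b < 0})"
    by (auto simp: neg_orthant_def inner_axis')
  show ?thesis
    unfolding eq by (intro convex_INT convex_halfspace_lt)
qed

lemma continuous_on_log_max:
  assumes "s > 0" "continuous_on X g"
  shows "continuous_on X (\<lambda>x. log_max s (g x))"
  unfolding log_max_def
  using assms(1) by (intro continuous_on_vec_lambda continuous_intros assms(2)) auto

text \<open>Instantiated both with all \<open>minorants\<close> and with a single direction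
  \<open>{c}\<close>, so that the extremal function and its competitors share one
  construction.\<close>

locale nonneg_directions =
  fixes S :: "(real ^ 'n) set"
  assumes nonempty: "S \<noteq> {}" and nonneg: "c \<in> S \<Longrightarrow> 0 \<le> c $ j"
begin

lemma inner_mono:
  fixes x y :: "real ^ 'n"
  assumes "c \<in> S" "\<And>j. x $ j \<le> y $ j"
  shows "c \<bullet> x \<le> c \<bullet> y"
  unfolding inner_vec_def using assms nonneg by (auto intro!: sum_mono mult_left_mono)

lemma inner_nonpos:
  assumes "c \<in> S" "b \<in> neg_orthant"
  shows "c \<bullet> b \<le> 0"
  using inner_mono[OF assms(1), of b 0] assms(2) by (auto simp: neg_orthant_def less_imp_le)

lemma le_support_fun: "c \<in> S \<Longrightarrow> b \<in> neg_orthant \<Longrightarrow> c \<bullet> b \<le> support_fun S b"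
  unfolding support_fun_def using inner_nonpos by (intro cSUP_upper bdd_aboveI[of _ 0]) auto

lemma support_fun_le: "(\<And>c. c \<in> S \<Longrightarrow> c \<bullet> b \<le> M) \<Longrightarrow> support_fun S b \<le> M"
  unfolding support_fun_def using nonempty by (intro cSUP_least) auto

lemma support_fun_nonpos: "b \<in> neg_orthant \<Longrightarrow> support_fun S b \<le> 0"
  using inner_nonpos by (intro support_fun_le)

lemma support_fun_mono:
  fixes x y :: "real ^ 'n"
  assumes "x \<in> neg_orthant" "y \<in> neg_orthant" "\<And>j. x $ j \<le> y $ j"
  shows "support_fun S x \<le> support_fun S y"
  using inner_mono[OF _ assms(3)] le_support_fun[OF _ assms(2)] by (intro support_fun_le) (rule order_trans)

lemma support_fun_scaleR:
  assumes "k > 0" "b \<in> neg_orthant"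
  shows "support_fun S (k *\<^sub>R b) = k * support_fun S b"
proof (rule antisym)
  have kb: "k *\<^sub>R b \<in> neg_orthant"
    using assms by (simp add: neg_orthant_def mult_pos_neg)
  show "support_fun S (k *\<^sub>R b) \<le> k * support_fun S b"
    using le_support_fun[OF _ assms(2)] assms(1) by (intro support_fun_le) simp
  have "support_fun S b \<le> support_fun S (k *\<^sub>R b) / k"
    using le_support_fun[OF _ kb] assms(1) by (intro support_fun_le) (simp add: field_simps)
  then show "k * support_fun S b \<le> support_fun S (k *\<^sub>R b)"
    using assms(1) by (simp add: field_simps)
qed

lemma convex_on_support_fun: "convex_on neg_orthant (support_fun S)"
proof (rule convex_onI)
  fix t and x y :: "real ^ 'n" assume *: "0 < t" "t < (1::real)" "x \<in> neg_orthant" "y \<in> neg_orthant"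
  show "support_fun S ((1 - t) *\<^sub>R x + t *\<^sub>R y) \<le> (1 - t) * support_fun S x + t * support_fun S y"
  proof (rule support_fun_le)
    fix c assume "c \<in> S"
    then show "c \<bullet> ((1 - t) *\<^sub>R x + t *\<^sub>R y) \<le> (1 - t) * support_fun S x + t * support_fun S y"
      using * le_support_fun by (simp add: inner_add_right add_mono mult_left_mono)
  qed
next
  show "convex (neg_orthant :: (real ^ 'n) set)"
    by (rule convex_neg_orthant)
qed

lemma continuous_on_support_fun: "continuous_on neg_orthant (support_fun S)"
  by (rule convex_on_continuous[OF open_neg_orthant convex_on_support_fun])

lemma toric_psh_le: "0 < s \<Longrightarrow> s < 1 \<Longrightarrow> toric_psh S z \<le> ereal (support_fun S (log_max s z))"
  unfolding toric_psh_def by (intro INF_lower) auto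

lemma le_toric_psh:
  "(\<And>s. 0 < s \<Longrightarrow> s < 1 \<Longrightarrow> L \<le> ereal (support_fun S (log_max s z))) \<Longrightarrow> L \<le> toric_psh S z"
  unfolding toric_psh_def by (intro INF_greatest) auto

lemma toric_psh_nonpos:
  assumes "z \<in> unit_polydisk"
  shows "toric_psh S z \<le> 0"
proof -
  have "toric_psh S z \<le> ereal (support_fun S (log_max (1 / 2) z))"
    by (rule toric_psh_le) auto
  also have "\<dots> \<le> 0"
    using support_fun_nonpos[OF log_max_mem_neg_orthant[OF assms, of "1 / 2"]] by simp
  finally show ?thesis .
qed

lemma support_fun_log_max_mono:
  fixes z w :: "complex ^ 'n"
  assumes "z \<in> unit_polydisk" "w \<in> unit_polydisk" "0 < s" "s \<le> s'" "s' < 1"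
    "\<And>j. norm (z $ j) \<le> norm (w $ j)"
  shows "support_fun S (log_max s z) \<le> support_fun S (log_max s' w)"
proof (rule support_fun_mono)
  show "log_max s z $ j \<le> log_max s' w $ j" for j
  proof -
    have "max (norm (z $ j)) s \<le> max (norm (w $ j)) s'"
      using assms(4,6) by (intro max.mono)
    then show ?thesis
      unfolding log_max_def using assms(3,4) by (simp add: ln_mono)
  qed
qed (use assms in \<open>auto intro!: log_max_mem_neg_orthant\<close>)

lemma toric_psh_mono:
  fixes z w :: "complex ^ 'n"
  assumes "z \<in> unit_polydisk" "w \<in> unit_polydisk" "\<And>j. norm (z $ j) \<le> norm (w $ j)"
  shows "toric_psh S z \<le> toric_psh S w"
proof (rule le_toric_psh)
  fix s :: real assume "0 < s" "s < 1"
  then show "toric_psh S z \<le> ereal (support_fun S (log_max s w))"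
    using toric_psh_le[of s z] support_fun_log_max_mono[OF assms(1,2), of s s] assms(3)
    by (meson ereal_less_eq(3) order_refl order_trans)
qed

lemma toric_psh_eq:
  fixes z :: "complex ^ 'n"
  assumes z: "z \<in> unit_polydisk" "\<And>j. z $ j \<noteq> 0"
  shows "toric_psh S z = ereal (support_fun S (log_norm z))"
proof (rule antisym)
  have lz: "log_norm z \<in> neg_orthant"
    using log_norm_mem_neg_orthant z by blast
  \<comment> \<open>At the level of the smallest modulus no coordinate is truncated.\<close>
  define s where "s = Min (range (\<lambda>j. norm (z $ j)))"
  have "s \<in> range (\<lambda>j. norm (z $ j))"
    unfolding s_def by (intro Min_in) auto
  then have s: "0 < s" "s < 1"
    using z by (auto simp: unit_polydisk_def)
  have "s \<le> norm (z $ j)" for j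
    unfolding s_def by simp
  then have "log_max s z = log_norm z"
    unfolding log_max_def log_norm_def by (simp add: max_absorb1)
  then show "toric_psh S z \<le> ereal (support_fun S (log_norm z))"
    using toric_psh_le[OF s, of z] by simp
  show "ereal (support_fun S (log_norm z)) \<le> toric_psh S z"
  proof (rule le_toric_psh)
    fix s :: real assume s: "0 < s" "s < 1"
    have "support_fun S (log_norm z) \<le> support_fun S (log_max s z)"
      using z lz log_max_mem_neg_orthant[OF z(1) s]
      by (intro support_fun_mono) (auto simp: log_norm_def log_max_def ln_mono)
    then show "ereal (support_fun S (log_norm z)) \<le> ereal (support_fun S (log_max s z))"
      by simp
  qed
qed

text \<open>An infimum of continuous functions: one truncation with value below y at z stays below y
  nearby.\<close>

lemma usc_on_toric_psh: "usc_on (toric_psh S) unit_polydisk"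
  unfolding usc_on_iff_open[OF open_unit_polydisk]
proof safe
  fix z y assume z: "z \<in> unit_polydisk" "toric_psh S z < y"
  then obtain s where s: "0 < s" "s < 1" "ereal (support_fun S (log_max s z)) < y"
    unfolding toric_psh_def INF_less_iff by auto
  obtain a where a: "support_fun S (log_max s z) < a" "ereal a < y"
    using ereal_dense2[OF s(3)] by auto
  have "continuous_on unit_polydisk (\<lambda>z. support_fun S (log_max s z))"
    using s log_max_mem_neg_orthant
    by (intro continuous_on_compose2[OF continuous_on_support_fun] continuous_on_log_max continuous_intros) auto
  then have "filterlim (\<lambda>z. support_fun S (log_max s z)) (nhds (support_fun S (log_max s z))) (nhds z)"
    using open_unit_polydisk z(1) by (rule continuous_on_open_tendsto_nhds)
  then have "\<forall>\<^sub>F x in nhds z. support_fun S (log_max s x) < a"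
    using a(1) by (rule order_tendstoD)
  then show "\<forall>\<^sub>F x in nhds z. toric_psh S x < y"
  proof eventually_elim
    case (elim x)
    have "toric_psh S x \<le> ereal (support_fun S (log_max s x))"
      by (rule toric_psh_le[OF s(1,2)])
    also have "\<dots> < ereal a" using elim by simp
    also have "\<dots> < y" by (rule a(2))
    finally show ?case .
  qed
qed

text \<open>Each k in S gives a nonnegative combination of truncated logarithms of affine functions,
  so the inequality holds coordinate by coordinate; the supremum over k is taken after
  integration.\<close>

lemma support_fun_log_max_submean:
  fixes a b :: "complex ^ 'n"
  assumes s: "0 < s" "s < 1" and r: "0 < r"
    and D: "\<And>\<zeta>. norm (\<zeta> - c) \<le> r \<Longrightarrow> a + \<zeta> *s b \<in> unit_polydisk"
  shows "ereal (support_fun S (log_max s (a + c *s b)))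
      \<le> circle_mean (\<lambda>\<zeta>. ereal (support_fun S (log_max s (a + \<zeta> *s b)))) c r"
    and "continuous_on UNIV (\<lambda>t. support_fun S (log_max s (a + (c + of_real r * cis t) *s b)))"
proof -
  let ?z = "\<lambda>t. a + (c + of_real r * cis t) *s b"
  let ?g = "\<lambda>t. support_fun S (log_max s (?z t))"
  have zD: "?z t \<in> unit_polydisk" for t
    using r by (intro D) (simp add: norm_mult)
  have zN: "log_max s (?z t) \<in> neg_orthant" for t
    by (intro log_max_mem_neg_orthant zD s)
  have cz: "continuous_on X ?z" for X
    unfolding vector_scalar_mult_def
    by (intro continuous_intros continuous_on_vec_lambda continuous_on_compose2[OF continuous_on_cis]) auto
  show cont: "continuous_on UNIV ?g"
    by (intro continuous_on_compose2[OF continuous_on_support_fun] continuous_on_log_max s cz) (use zN in auto)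
  have cont': "continuous_on {0..2*pi} ?g"
    using cont continuous_on_subset by blast
  define I where "I = integral {0..2*pi} ?g"
  have I: "(?g has_integral I) {0..2*pi}"
    unfolding I_def by (intro integrable_integral integrable_continuous_real cont')
  have "support_fun S (log_max s (a + c *s b)) \<le> I / (2 * pi)"
  proof (rule support_fun_le)
    fix k assume k: "k \<in> S"
    let ?J = "\<lambda>j. integral {0..2*pi} (\<lambda>t. ln (max (norm (a $ j + c * b $ j + of_real r * b $ j * cis t)) s))"
    have J: "((\<lambda>t. ln (max (norm (a $ j + c * b $ j + of_real r * b $ j * cis t)) s)) has_integral ?J j) {0..2*pi}" for j
      using s(1) by (intro integrable_integral integrable_continuous_real continuous_intros
          continuous_on_compose2[OF continuous_on_cis]) auto
    have "2 * pi * (k \<bullet> log_max s (a + c *s b)) = (\<Sum>j\<in>UNIV. k $ j * (2 * pi * ln (max (norm (a $ j + c * b $ j)) s)))"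
      by (simp add: inner_vec_def log_max_def sum_distrib_left mult_ac)
    also have "\<dots> \<le> (\<Sum>j\<in>UNIV. k $ j * ?J j)"
      by (intro sum_mono mult_left_mono ln_max_circle_submean nonneg k s)
    also have "\<dots> \<le> I"
    proof (rule has_integral_le[OF _ I])
      show "((\<lambda>t. k \<bullet> log_max s (?z t)) has_integral (\<Sum>j\<in>UNIV. k $ j * ?J j)) {0..2*pi}"
      proof -
        have "k \<bullet> log_max s (?z t) =
            (\<Sum>j\<in>UNIV. k $ j * ln (max (norm (a $ j + c * b $ j + of_real r * b $ j * cis t)) s))" for t
          by (simp add: inner_vec_def log_max_def algebra_simps)
        then show ?thesis
          by (simp only:) (intro has_integral_sum has_integral_mult_right J finite)
      qed
      show "k \<bullet> log_max s (?z t) \<le> ?g t" for t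
        by (intro le_support_fun k zN)
    qed
    finally show "k \<bullet> log_max s (a + c *s b) \<le> I / (2 * pi)"
      by (simp add: field_simps)
  qed
  moreover have "circle_mean (\<lambda>\<zeta>. ereal (support_fun S (log_max s (a + \<zeta> *s b)))) c r = ereal (I / (2 * pi))"
    by (rule circle_mean_of_has_integral[OF I cont]) simp
  ultimately show "ereal (support_fun S (log_max s (a + c *s b)))
      \<le> circle_mean (\<lambda>\<zeta>. ereal (support_fun S (log_max s (a + \<zeta> *s b)))) c r"
    by simp
qed

text \<open>Monotone convergence wants a sequence of levels; the offset 2 keeps them below 1 from
  \<open>n = 0\<close> on.\<close>

lemma toric_psh_eq_INF_nat:
  assumes "z \<in> unit_polydisk"
  shows "toric_psh S z = (INF n. ereal (support_fun S (log_max (1 / real (n + 2)) z)))"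
proof (rule antisym)
  show "toric_psh S z \<le> (INF n. ereal (support_fun S (log_max (1 / real (n + 2)) z)))"
    by (intro INF_greatest toric_psh_le) auto
  show "(INF n. ereal (support_fun S (log_max (1 / real (n + 2)) z))) \<le> toric_psh S z"
  proof (rule le_toric_psh)
    fix s :: real assume s: "0 < s" "s < 1"
    obtain n where n: "inverse (real (Suc n)) < s"
      using reals_Archimedean[OF s(1)] by blast
    have "1 / real (n + 2) \<le> inverse (real (Suc n))"
      by (simp add: field_simps)
    then have "support_fun S (log_max (1 / real (n + 2)) z) \<le> support_fun S (log_max s z)"
      using s n assms by (intro support_fun_log_max_mono) auto
    then show "(INF n. ereal (support_fun S (log_max (1 / real (n + 2)) z))) \<le> ereal (support_fun S (log_max s z))"
      by (intro INF_lower2[of n]) auto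
  qed
qed

lemma psh_on_toric_psh: "psh_on (toric_psh S) unit_polydisk"
  unfolding psh_on_def
proof (intro conjI ballI allI)
  show "toric_psh S z < \<infinity>" if "z \<in> unit_polydisk" for z
    using toric_psh_nonpos[OF that] by auto
  fix a b :: "complex ^ 'n"
  let ?V = "{\<zeta>. a + \<zeta> *s b \<in> unit_polydisk}"
  have cl: "continuous_on X (\<lambda>\<zeta>. a + \<zeta> *s b)" for X
    unfolding vector_scalar_mult_def by (intro continuous_intros continuous_on_vec_lambda)
  have V: "open ?V"
    using open_vimage[OF open_unit_polydisk cl] by (simp add: vimage_def)
  show "subharmonic_on (\<lambda>\<zeta>. toric_psh S (a + \<zeta> *s b)) ?V"
    unfolding subharmonic_on_def
  proof (intro conjI ballI allI impI V)
    show "toric_psh S (a + z *s b) < \<infinity>" if "z \<in> ?V" for z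
      using toric_psh_nonpos that by force
    show "usc_on (\<lambda>\<zeta>. toric_psh S (a + \<zeta> *s b)) ?V"
      by (rule usc_on_compose[OF usc_on_toric_psh open_unit_polydisk V cl]) auto
    fix c r assume cr: "0 < r \<and> cball c r \<subseteq> ?V"
    then have D: "a + \<zeta> *s b \<in> unit_polydisk" if "norm (\<zeta> - c) \<le> r" for \<zeta>
      using that by (auto simp: subset_iff dist_norm norm_minus_commute)
    have D': "a + (c + of_real r * cis t) *s b \<in> unit_polydisk" for t
      using cr by (intro D) (simp add: norm_mult)
    let ?s = "\<lambda>n. 1 / real (n + 2)"
    have s: "0 < ?s n" "?s n < 1" for n by auto
    show "toric_psh S (a + c *s b) \<le> circle_mean (\<lambda>\<zeta>. toric_psh S (a + \<zeta> *s b)) c r"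
    proof (rule circle_mean_decreasing_limit[where h = "\<lambda>n \<zeta>. support_fun S (log_max (?s n) (a + \<zeta> *s b))"])
      fix n
      show "continuous_on UNIV (\<lambda>t. support_fun S (log_max (?s n) (a + (c + of_real r * cis t) *s b)))"
        by (rule support_fun_log_max_submean(2)[OF s _ D]) (use cr in auto)
      show "toric_psh S (a + c *s b) \<le> circle_mean (\<lambda>\<zeta>. ereal (support_fun S (log_max (?s n) (a + \<zeta> *s b)))) c r"
        by (rule order_trans[OF toric_psh_le[OF s] support_fun_log_max_submean(1)[OF s _ D]])
          (use cr in auto)
      show "support_fun S (log_max (?s n) (a + (c + of_real r * cis t) *s b)) \<le> 0" for t
        by (intro support_fun_nonpos log_max_mem_neg_orthant D' s)
      show "support_fun S (log_max (?s (Suc n)) (a + (c + of_real r * cis t) *s b))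
        \<le> support_fun S (log_max (?s n) (a + (c + of_real r * cis t) *s b))" for t
        by (intro support_fun_log_max_mono D') (auto simp: field_simps)
      show "toric_psh S (a + (c + of_real r * cis t) *s b)
        = (INF n. ereal (support_fun S (log_max (?s n) (a + (c + of_real r * cis t) *s b))))" for t
        by (rule toric_psh_eq_INF_nat[OF D'])
    qed
  qed
qed (use open_unit_polydisk usc_on_toric_psh in auto)

end

section \<open>Points on the coordinate hyperplanes\<close>

text \<open>Leaves all hyperplanes at once, never lowers a modulus, and tends to z as s tends to
  0.\<close>

definition fill_zeros :: "real \<Rightarrow> complex ^ 'n \<Rightarrow> complex ^ 'n" where
  "fill_zeros s z = (\<chi> j. if z $ j = 0 then of_real s else z $ j)"

lemma fill_zeros_mem: "z \<in> unit_polydisk \<Longrightarrow> 0 < s \<Longrightarrow> s < 1 \<Longrightarrow> fill_zeros s z \<in> unit_polydisk"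
  by (auto simp: fill_zeros_def unit_polydisk_def)

lemma fill_zeros_nonzero: "0 < s \<Longrightarrow> fill_zeros s z $ j \<noteq> 0"
  by (simp add: fill_zeros_def)

lemma norm_le_fill_zeros: "0 < s \<Longrightarrow> norm (z $ j) \<le> norm (fill_zeros s z $ j)"
  by (simp add: fill_zeros_def)

lemma eventually_fill_zeros:
  assumes "\<forall>\<^sub>F x in nhds z. P x"
  shows "\<exists>s. 0 < s \<and> s < 1 \<and> P (fill_zeros s z)"
proof -
  have "((\<lambda>s. fill_zeros s z) \<longlongrightarrow> z) (at_right 0)"
    unfolding fill_zeros_def
  proof (rule vec_tendstoI)
    fix j
    show "((\<lambda>s. (\<chi> j. if z $ j = 0 then of_real s else z $ j) $ j) \<longlongrightarrow> z $ j) (at_right 0)"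
      by (cases "z $ j = 0") (auto intro!: tendsto_eq_intros)
  qed
  with assms have "\<forall>\<^sub>F s in at_right 0. P (fill_zeros s z)"
    by (rule eventually_compose_filterlim)
  moreover have "\<forall>\<^sub>F s in at_right (0::real). s \<in> {0<..<1}"
    by (rule eventually_at_right_real) simp
  ultimately have "\<forall>\<^sub>F s in at_right 0. P (fill_zeros s z) \<and> s \<in> {0<..<1}"
    by (rule eventually_conj)
  from eventually_happens[OF this] show ?thesis by auto
qed

lemma usc_fill_zeros:
  assumes "usc_on w unit_polydisk" "z \<in> unit_polydisk"
    and L: "\<And>s. 0 < s \<Longrightarrow> s < 1 \<Longrightarrow> L \<le> w (fill_zeros s z)"
  shows "L \<le> w z"
proof (rule ccontr)
  assume "\<not> L \<le> w z"
  then have "\<forall>\<^sub>F x in nhds z. w x < L"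
    using assms(1,2) by (simp add: usc_on_iff_open[OF open_unit_polydisk])
  from eventually_fill_zeros[OF this] L show False
    by (auto simp: not_le[symmetric])
qed

text \<open>Moving all zero coordinates simultaneously by \<zeta> stays in one complex line, and on
  the circle of radius s the moduli are those of \<open>fill_zeros s z\<close>.\<close>

lemma psh_le_fill_zeros:
  fixes v :: "complex ^ 'n \<Rightarrow> ereal"
  assumes psh: "psh_on v unit_polydisk" and z: "z \<in> unit_polydisk" and s: "0 < s" "s < 1"
    and M: "\<And>y. y \<in> unit_polydisk \<Longrightarrow> (\<And>j. norm (y $ j) = norm (fill_zeros s z $ j)) \<Longrightarrow> v y \<le> ereal M"
  shows "v z \<le> ereal M"
proof -
  define b :: "complex ^ 'n" where "b = (\<chi> j. if z $ j = 0 then 1 else 0)"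
  have D: "z + \<zeta> *s b \<in> unit_polydisk" if "norm (\<zeta> - 0) \<le> s" for \<zeta>
  proof -
    have "norm ((z + \<zeta> *s b) $ j) < 1" for j
      using z s that by (cases "z $ j = 0") (simp_all add: unit_polydisk_def b_def)
    then show ?thesis by (simp add: unit_polydisk_def)
  qed
  have "v (z + 0 *s b) \<le> circle_mean (\<lambda>\<zeta>. v (z + \<zeta> *s b)) 0 s"
    by (rule psh_line_submean[OF psh s(1) D])
  also have "\<dots> \<le> circle_mean (\<lambda>\<zeta>. ereal M) 0 s"
  proof (rule circle_mean_mono)
    fix t :: real
    show "v (z + (0 + of_real s * cis t) *s b) \<le> ereal M"
    proof (rule M)
      show "z + (0 + of_real s * cis t) *s b \<in> unit_polydisk"
        using s by (intro D) (simp add: norm_mult)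
      show "norm ((z + (0 + of_real s * cis t) *s b) $ j) = norm (fill_zeros s z $ j)" for j
        using s by (simp add: b_def fill_zeros_def norm_mult)
    qed
  qed
  finally show ?thesis
    by (simp add: circle_mean_const)
qed

text \<open>Allows replacing a function by its restriction to the polydisk, as the extensional
  indicator demands: the circles tested lie inside D.\<close>

lemma psh_on_cong:
  assumes "psh_on f D" "\<And>z. z \<in> D \<Longrightarrow> f z = g z"
  shows "psh_on g D"
proof -
  have D: "open D" using assms(1) by (simp add: psh_on_def)
  have usc: "usc_on g' V" if "usc_on f' V" "open V" "\<And>z. z \<in> V \<Longrightarrow> f' z = g' z"
    for f' g' :: "'z::topological_space \<Rightarrow> ereal" and V
    unfolding usc_on_iff_open[OF that(2)]
  proof safe
    fix z y assume z: "z \<in> V" "g' z < y"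
    then have "\<forall>\<^sub>F x in nhds z. f' x < y"
      using that by (simp add: usc_on_iff_open)
    moreover have "\<forall>\<^sub>F x in nhds z. x \<in> V"
      using that(2) z(1) by (rule eventually_nhds_in_open)
    ultimately show "\<forall>\<^sub>F x in nhds z. g' x < y"
      by eventually_elim (use that(3) in auto)
  qed
  show ?thesis
    unfolding psh_on_def
  proof (intro conjI ballI allI D)
    show fin: "g z < \<infinity>" if "z \<in> D" for z
      using assms(1) assms(2)[OF that] that unfolding psh_on_def by metis
    have "usc_on f D"
      using assms(1) unfolding psh_on_def by blast
    then show "usc_on g D"
      using D assms(2) by (rule usc)
    fix a b
    have sub: "subharmonic_on (\<lambda>\<zeta>. f (a + \<zeta> *s b)) {\<zeta>. a + \<zeta> *s b \<in> D}"
      using assms(1) unfolding psh_on_def by blast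
    show "subharmonic_on (\<lambda>\<zeta>. g (a + \<zeta> *s b)) {\<zeta>. a + \<zeta> *s b \<in> D}"
      unfolding subharmonic_on_def
    proof (intro conjI ballI allI impI)
      show op: "open {\<zeta>. a + \<zeta> *s b \<in> D}"
        using sub by (simp add: subharmonic_on_def)
      show "g (a + z *s b) < \<infinity>" if "z \<in> {\<zeta>. a + \<zeta> *s b \<in> D}" for z
        using fin that by blast
      have "usc_on (\<lambda>\<zeta>. f (a + \<zeta> *s b)) {\<zeta>. a + \<zeta> *s b \<in> D}"
        using sub unfolding subharmonic_on_def by blast
      then show "usc_on (\<lambda>\<zeta>. g (a + \<zeta> *s b)) {\<zeta>. a + \<zeta> *s b \<in> D}"
        using op by (rule usc) (simp add: assms(2))
      fix c r assume cr: "0 < r \<and> cball c r \<subseteq> {\<zeta>. a + \<zeta> *s b \<in> D}"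
      then have "f (a + c *s b) \<le> circle_mean (\<lambda>\<zeta>. f (a + \<zeta> *s b)) c r"
        using sub unfolding subharmonic_on_def by blast
      also have "\<dots> \<le> circle_mean (\<lambda>\<zeta>. g (a + \<zeta> *s b)) c r"
      proof (rule circle_mean_mono)
        fix t :: real
        have "c + of_real r * cis t \<in> cball c r"
          using cr by (simp add: dist_norm norm_mult)
        then have "a + (c + of_real r * cis t) *s b \<in> D"
          using cr by auto
        then show "f (a + (c + of_real r * cis t) *s b) \<le> g (a + (c + of_real r * cis t) *s b)"
          using assms(2) by simp
      qed
      also have "f (a + c *s b) = g (a + c *s b)"
      proof (rule assms(2))
        have "c \<in> cball c r" using cr by simp
        then show "a + c *s b \<in> D" using cr by blast
      qed
      finally show "g (a + c *s b) \<le> circle_mean (\<lambda>\<zeta>. g (a + \<zeta> *s b)) c r" .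
    qed
  qed
qed

lemma log_norm_torus_point [simp]: "log_norm (torus_point b \<theta>) = b"
  by (simp add: log_norm_def vec_eq_iff)

lemma torus_point_nonzero: "torus_point b \<theta> $ j \<noteq> 0"
  by (simp add: torus_point_def)

lemma ex_torus_point_log_norm:
  fixes z :: "complex ^ 'n"
  assumes "\<And>j. z $ j \<noteq> 0"
  shows "\<exists>\<theta>. z = torus_point (log_norm z) \<theta>"
  using ex_torus_point[of z "log_norm z"] assms by (auto simp: log_norm_def)

text \<open>The moduli \<open>exp (t * b $ j)\<close> tend to 0 and do not involve the angles, hence
  the uniformity in \<theta>.\<close>

lemma eventually_torus_point_near_0:
  fixes b :: "real ^ 'n"
  assumes "b \<in> neg_orthant" "\<forall>\<^sub>F z in nhds 0. P z"
  shows "\<forall>\<^sub>F t in at_top. \<forall>\<theta>. P (torus_point (t *\<^sub>R b) \<theta>)"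
proof -
  obtain \<delta> where \<delta>: "\<delta> > 0" "\<And>z. dist z 0 < \<delta> \<Longrightarrow> P z"
    using assms(2) unfolding eventually_nhds_metric by blast
  have "((\<lambda>t. exp (t * b $ j)) \<longlongrightarrow> 0) at_top" for j
  proof (rule filterlim_compose[OF exp_at_bot])
    show "filterlim (\<lambda>t. t * b $ j) at_bot at_top"
      using assms(1) filterlim_tendsto_neg_mult_at_bot[OF tendsto_const _ filterlim_ident, of "b $ j"]
      by (simp add: neg_orthant_def mult.commute)
  qed
  then have "((\<lambda>t. \<Sum>j\<in>UNIV. exp (t * b $ j)) \<longlongrightarrow> (\<Sum>j\<in>(UNIV :: 'n set). 0)) at_top"
    by (intro tendsto_sum)
  then have "\<forall>\<^sub>F t in at_top. (\<Sum>j\<in>UNIV. exp (t * b $ j)) < \<delta>"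
    using \<delta>(1) by (intro order_tendstoD(2)) auto
  then show ?thesis
  proof eventually_elim
    case (elim t)
    show ?case
    proof
      fix \<theta>
      have "norm (torus_point (t *\<^sub>R b) \<theta>) \<le> (\<Sum>j\<in>UNIV. norm (torus_point (t *\<^sub>R b) \<theta> $ j))"
        unfolding norm_vec_def by (rule L2_set_le_sum) auto
      then show "P (torus_point (t *\<^sub>R b) \<theta>)"
        using elim by (intro \<delta>(2)) simp
    qed
  qed
qed

text \<open>Filling zeros with s raises each logarithm at most to its truncation at s. Used both for
  the competitors of the greenification and for uniqueness of the indicator.\<close>

lemma (in nonneg_directions) psh_le_toric_psh:
  assumes psh: "psh_on v unit_polydisk"
    and le: "\<And>x. x \<in> unit_polydisk \<Longrightarrow> (\<And>j. x $ j \<noteq> 0) \<Longrightarrow> v x \<le> ereal (support_fun S (log_norm x))"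
    and z: "z \<in> unit_polydisk"
  shows "v z \<le> toric_psh S z"
proof (rule le_toric_psh)
  fix s :: real assume s: "0 < s" "s < 1"
  have fz: "fill_zeros s z \<in> unit_polydisk" "log_norm (fill_zeros s z) \<in> neg_orthant"
    using fill_zeros_mem[OF z s] fill_zeros_nonzero[OF s(1)] log_norm_mem_neg_orthant by blast+
  have "v z \<le> ereal (support_fun S (log_norm (fill_zeros s z)))"
  proof (rule psh_le_fill_zeros[OF psh z s])
    fix y assume y: "y \<in> unit_polydisk" "\<And>j. norm (y $ j) = norm (fill_zeros s z $ j)"
    then have "log_norm y = log_norm (fill_zeros s z)"
      by (simp add: log_norm_def)
    moreover have "y $ j \<noteq> 0" for j
      using y(2)[of j] fill_zeros_nonzero[OF s(1), of z j] by auto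
    ultimately show "v y \<le> ereal (support_fun S (log_norm (fill_zeros s z)))"
      using le[OF y(1)] by simp
  qed
  also have "support_fun S (log_norm (fill_zeros s z)) \<le> support_fun S (log_max s z)"
  proof (rule support_fun_mono[OF fz(2) log_max_mem_neg_orthant[OF z s]])
    show "log_norm (fill_zeros s z) $ j \<le> log_max s z $ j" for j
      using s by (auto simp: log_norm_def log_max_def fill_zeros_def ln_mono max_def)
  qed
  finally show "v z \<le> ereal (support_fun S (log_max s z))"
    by simp
qed

section \<open>Multi-circled functions\<close>

text \<open>A hyperplane separating the epigraph from the open vertical ray below
  \<open>(x0, f x0)\<close> has the subgradient as its slope.\<close>

lemma convex_on_subgradient:
  fixes f :: "'a::euclidean_space \<Rightarrow> real"
  assumes "open X" "convex_on X f" "x0 \<in> X"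
  shows "\<exists>c. \<forall>x\<in>X. f x0 + c \<bullet> (x - x0) \<le> f x"
proof -
  let ?R = "{x0} \<times> {..<f x0}"
  have "convex (epigraph X f)" "convex ?R"
    using assms(2) by (intro convex_epigraphI convex_Times; simp)+
  moreover have "(x0, f x0) \<in> epigraph X f" "(x0, f x0 - 1) \<in> ?R"
    using assms(3) by (auto simp: mem_epigraph)
  then have "epigraph X f \<noteq> {}" "?R \<noteq> {}"
    by blast+
  moreover have "epigraph X f \<inter> ?R = {}"
    by (auto simp: epigraph_def)
  ultimately have "\<exists>a \<beta>. a \<noteq> 0 \<and> (\<forall>x\<in>epigraph X f. a \<bullet> x \<le> \<beta>) \<and> (\<forall>x\<in>?R. \<beta> \<le> a \<bullet> x)"
    by (rule separating_hyperplane_sets)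
  then obtain a \<beta> where a: "a \<noteq> 0" "\<And>x. x \<in> epigraph X f \<Longrightarrow> a \<bullet> x \<le> \<beta>"
      "\<And>x. x \<in> ?R \<Longrightarrow> \<beta> \<le> a \<bullet> x"
    by blast
  obtain a1 a2 where a12: "a = (a1, a2)" by (cases a)
  have up: "a1 \<bullet> x + a2 * y \<le> \<beta>" if "x \<in> X" "f x \<le> y" for x y
    using a(2)[of "(x, y)"] that by (simp add: a12 mem_epigraph)
  have lo: "\<beta> \<le> a1 \<bullet> x0 + a2 * y" if "y < f x0" for y
    using a(3)[of "(x0, y)"] that by (simp add: a12)
  have a2le: "a2 \<le> 0"
    using up[OF assms(3), of "f x0 + 1"] lo[of "f x0 - 1"] by (simp add: algebra_simps)
  \<comment> \<open>A vertical hyperplane would put X in a half-space with x0 on its boundary; a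
    step from x0 along a1 inside the ball of radius e refutes this.\<close>
  have "a2 \<noteq> 0"
  proof
    assume "a2 = 0"
    then have "a1 \<noteq> 0" using a(1) a12 by (simp add: zero_prod_def)
    obtain e where e: "e > 0" "ball x0 e \<subseteq> X"
      using assms(1,3) open_contains_ball by blast
    let ?x = "x0 + (e / (2 * norm a1)) *\<^sub>R a1"
    have "?x \<in> X"
      using e \<open>a1 \<noteq> 0\<close> by (intro subsetD[OF e(2)]) (simp add: dist_norm)
    then have "a1 \<bullet> ?x \<le> a1 \<bullet> x0"
      using up[of ?x "f ?x"] lo[of "f x0 - 1"] \<open>a2 = 0\<close> by simp
    then have "(e / (2 * norm a1)) * (a1 \<bullet> a1) \<le> 0"
      by (simp add: inner_add_right)
    moreover have "(e / (2 * norm a1)) * (a1 \<bullet> a1) > 0"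
      using e(1) \<open>a1 \<noteq> 0\<close> by (intro mult_pos_pos divide_pos_pos) auto
    ultimately show False by linarith
  qed
  then have a2: "a2 < 0" using a2le by simp
  have lim: "\<beta> \<le> a1 \<bullet> x0 + a2 * f x0"
  proof (rule field_le_epsilon)
    fix e :: real assume "e > 0"
    then have "\<beta> \<le> a1 \<bullet> x0 + a2 * (f x0 - e / (- a2))"
      using a2 by (intro lo) (simp add: divide_pos_neg)
    also have "a2 * (f x0 - e / (- a2)) = a2 * f x0 + e"
      using a2 by (simp add: field_simps)
    finally show "\<beta> \<le> a1 \<bullet> x0 + a2 * f x0 + e" by simp
  qed
  show ?thesis
  proof (intro exI ballI)
    fix x assume "x \<in> X"
    then have "a1 \<bullet> x + a2 * f x \<le> a1 \<bullet> x0 + a2 * f x0"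
      using up[of x "f x"] lim by simp
    then have "a1 \<bullet> (x - x0) \<le> (- a2) * (f x - f x0)"
      by (simp add: inner_diff_right algebra_simps)
    then have "(a1 \<bullet> (x - x0)) / (- a2) \<le> f x - f x0"
      using a2 by (subst pos_divide_le_eq) (auto simp: mult.commute)
    then show "f x0 + ((1 / (- a2)) *\<^sub>R a1) \<bullet> (x - x0) \<le> f x"
      by simp
  qed
qed

section \<open>Finiteness, convexity and linear minorants in logarithmic coordinates\<close>

locale multicircled_psh =
  fixes u :: "complex ^ 'n \<Rightarrow> ereal"
  assumes u_PSH: "u \<in> PSH_neg unit_polydisk" and u_mult: "multicircled_on u unit_polydisk"
begin

lemma psh: "psh_on u unit_polydisk" and u_nonpos: "z \<in> unit_polydisk \<Longrightarrow> u z \<le> 0"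
  using u_PSH by (auto simp: PSH_neg_def)

lemma u_eq:
  fixes z w :: "complex ^ 'n"
  assumes "z \<in> unit_polydisk" "w \<in> unit_polydisk" "\<And>j. norm (z $ j) = norm (w $ j)"
  shows "u z = u w"
proof -
  have "u z = u (\<chi> j. complex_of_real (norm (z $ j)))" "u w = u (\<chi> j. complex_of_real (norm (w $ j)))"
    using u_mult assms(1,2) unfolding multicircled_on_def by blast+
  then show ?thesis
    using assms(3) by presburger
qed

text \<open>\<open>real_of_ereal\<close> would send -\<infinity> to 0, so the value is faithful only
  after \<open>u_not_minf\<close>.\<close>

definition log_u :: "real ^ 'n \<Rightarrow> real" where
  "log_u b = real_of_ereal (u (torus_point b 0))"

lemma u_torus_point_indep: "b \<in> neg_orthant \<Longrightarrow> u (torus_point b \<theta>) = u (torus_point b 0)"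
  by (intro u_eq torus_point_mem_unit_polydisk) auto

lemma u_not_minf_somewhere: "\<exists>b\<in>neg_orthant. u (torus_point b 0) \<noteq> -\<infinity>"
proof (rule ccontr)
  assume no: "\<not> ?thesis"
  obtain z where z: "z \<in> unit_polydisk" "u z \<noteq> -\<infinity>"
    using u_PSH by (auto simp: PSH_neg_def)
  have "u z \<le> ereal M" for M
  proof (rule psh_le_fill_zeros[OF psh z(1), of "1/2"])
    fix y assume y: "y \<in> unit_polydisk" "\<And>j. norm (y $ j) = norm (fill_zeros (1/2) z $ j)"
    have nz: "y $ j \<noteq> 0" for j
      using y(2)[of j] fill_zeros_nonzero[of "1/2" z j] by auto
    then obtain \<theta> where \<theta>: "y = torus_point (log_norm y) \<theta>"
      using ex_torus_point_log_norm by blast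
    have l: "log_norm y \<in> neg_orthant"
      using log_norm_mem_neg_orthant y(1) nz by blast
    have "u y = u (torus_point (log_norm y) 0)"
      using u_torus_point_indep[OF l, of \<theta>] \<theta> by simp
    also have "\<dots> = -\<infinity>"
      using no l by blast
    finally show "u y \<le> ereal M" by simp
  qed auto
  then have "u z = -\<infinity>"
    by (intro ereal_bot)
  then show False using z by simp
qed

text \<open>Extend the segment from b to a point b1 of finiteness slightly beyond b1, to q.
  Convexity with an arbitrarily negative bound at b and the bound 0 at q would force -\<infinity> at
  b1.\<close>

lemma u_not_minf:
  assumes b: "b \<in> neg_orthant"
  shows "u (torus_point b 0) \<noteq> -\<infinity>"
proof
  assume minf: "u (torus_point b 0) = -\<infinity>"
  obtain b1 where b1: "b1 \<in> neg_orthant" "u (torus_point b1 0) \<noteq> -\<infinity>"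
    using u_not_minf_somewhere by blast
  obtain e where e: "e > 0" "ball b1 e \<subseteq> neg_orthant"
    using open_neg_orthant b1(1) open_contains_ball by blast
  define \<tau> where "\<tau> = e / (2 * (norm (b1 - b) + 1))"
  have \<tau>: "\<tau> > 0" using e(1) by (auto simp: \<tau>_def intro!: divide_pos_pos add_nonneg_pos)
  define q where "q = b1 + \<tau> *\<^sub>R (b1 - b)"
  have "norm (\<tau> *\<^sub>R (b1 - b)) \<le> \<tau> * (norm (b1 - b) + 1)"
    using \<tau> by simp
  also have "\<dots> = e / 2"
  proof -
    have "norm (b1 - b) + 1 \<noteq> 0"
      using norm_ge_zero[of "b1 - b"] by linarith
    moreover have "e / (2 * x) * x = e / 2" if "x \<noteq> 0" for x :: real
      using that by simp
    ultimately show ?thesis unfolding \<tau>_def by blast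
  qed
  also have "\<dots> < e" using e(1) by simp
  finally have q: "q \<in> neg_orthant"
    using e(2) by (auto simp: q_def dist_norm subset_iff)
  define t where "t = 1 / (1 + \<tau>)"
  have t: "0 < t" "t < 1" using \<tau> by (auto simp: t_def)
  have "b + t *\<^sub>R (q - b) = b1"
  proof -
    have "q - b = (1 + \<tau>) *\<^sub>R (b1 - b)"
      by (simp add: q_def algebra_simps)
    then show ?thesis using \<tau> by (simp add: t_def)
  qed
  moreover have "u (torus_point (b + t *\<^sub>R (q - b)) 0) \<le> ereal ((1 - t) * \<alpha> + t * 0)" for \<alpha>
  proof (rule psh_torus_convex[OF psh u_nonpos b q])
    show "u (torus_point b \<theta>) \<le> ereal \<alpha>" for \<theta>
      unfolding u_torus_point_indep[OF b, of \<theta>] minf by simp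
    show "u (torus_point q \<theta>) \<le> ereal 0" for \<theta>
      using u_nonpos[OF torus_point_mem_unit_polydisk[OF q]] by (simp add: zero_ereal_def)
  qed (use t in auto)
  ultimately have bd: "u (torus_point b1 0) \<le> ereal ((1 - t) * \<alpha> + t * 0)" for \<alpha>
    by simp
  have "u (torus_point b1 0) \<le> ereal B" for B
    using bd[of "B / (1 - t)"] t by simp
  then have "u (torus_point b1 0) = -\<infinity>"
    by (intro ereal_bot)
  then show False using b1 by simp
qed

lemma u_torus_point:
  assumes b: "b \<in> neg_orthant"
  shows "u (torus_point b \<theta>) = ereal (log_u b)"
  unfolding u_torus_point_indep[OF b, of \<theta>] log_u_def
  using u_not_minf[OF b] u_nonpos[OF torus_point_mem_unit_polydisk[OF b], of 0]
  by (cases "u (torus_point b 0)") auto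

lemma log_u_nonpos: "b \<in> neg_orthant \<Longrightarrow> log_u b \<le> 0"
  using u_nonpos[OF torus_point_mem_unit_polydisk, of b 0] by (simp add: u_torus_point)

lemma convex_on_log_u: "convex_on neg_orthant log_u"
proof (rule convex_onI[OF _ convex_neg_orthant])
  fix t :: real and x y :: "real ^ 'n" assume t: "0 < t" "t < 1" and xy: "x \<in> neg_orthant" "y \<in> neg_orthant"
  have e: "(1 - t) *\<^sub>R x + t *\<^sub>R y = x + t *\<^sub>R (y - x)"
    by (simp add: algebra_simps)
  have "(1 - t) *\<^sub>R x + t *\<^sub>R y \<in> neg_orthant"
    using convex_neg_orthant xy t unfolding convex_alt by auto
  then show "log_u ((1 - t) *\<^sub>R x + t *\<^sub>R y) \<le> (1 - t) * log_u x + t * log_u y"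
    using psh_torus_convex[OF psh u_nonpos xy, of "log_u x" "log_u y" t 0] t xy
    unfolding e by (simp add: u_torus_point)
qed

text \<open>The directions of the functions \<open>\<Sum>\<^sub>j c\<^sub>j log |z\<^sub>j|\<close> in the class of \<open>u\<close>.\<close>

definition minorants :: "(real ^ 'n) set" where
  "minorants = {c. (\<forall>j. 0 \<le> c $ j) \<and> (\<exists>C. \<forall>b\<in>neg_orthant. c \<bullet> b \<le> log_u b + C)}"

lemma ex_minorant:
  assumes b: "b \<in> neg_orthant" and t: "t > 0"
  shows "\<exists>c\<in>minorants. log_u (t *\<^sub>R b) \<le> t * (c \<bullet> b)"
proof -
  define x0 where "x0 = t *\<^sub>R b"
  have sc: "k *\<^sub>R b \<in> neg_orthant" if "k > 0" for k
    using b that by (auto simp: neg_orthant_def mult_pos_neg)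
  have x0: "x0 \<in> neg_orthant" unfolding x0_def by (rule sc[OF t])
  obtain c where c: "\<And>x. x \<in> neg_orthant \<Longrightarrow> log_u x0 + c \<bullet> (x - x0) \<le> log_u x"
    using convex_on_subgradient[OF open_neg_orthant convex_on_log_u x0] by blast
  have c0: "0 \<le> c $ j" for j
  proof (rule ccontr)
    assume neg: "\<not> 0 \<le> c $ j"
    \<comment> \<open>The subgradient inequality at \<open>x0 - k *\<^sub>R axis j 1\<close> would
      give \<open>log_u\<close> a value of at least 1 there, against
      \<open>log_u_nonpos\<close>.\<close>
    define k where "k = (1 - log_u x0) / (- c $ j)"
    have k: "k > 0" unfolding k_def using neg log_u_nonpos[OF x0] by (intro divide_pos_pos) auto
    have m: "x0 - k *\<^sub>R axis j 1 \<in> neg_orthant"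
    proof -
      have "(x0 - k *\<^sub>R axis j 1) $ i \<le> x0 $ i" for i
        using k by (simp add: axis_def)
      then show ?thesis
        using x0 unfolding neg_orthant_def by (blast intro: le_less_trans)
    qed
    have "log_u x0 - k * c $ j \<le> 0"
      using c[OF m] log_u_nonpos[OF m] by (simp add: inner_axis inner_diff_right)
    moreover have "k * c $ j = log_u x0 - 1"
      using neg by (simp add: k_def field_simps)
    ultimately show False by simp
  qed
  have "c \<bullet> x \<le> log_u x + (c \<bullet> x0 - log_u x0)" if "x \<in> neg_orthant" for x
    using c[OF that] by (simp add: inner_diff_right)
  then have "c \<in> minorants"
    unfolding minorants_def using c0 by blast
  moreover have "log_u x0 \<le> t * (c \<bullet> b)"
  proof (rule field_le_epsilon)
    fix e :: real assume e: "e > 0"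
    \<comment> \<open>The subgradient inequality at \<open>k *\<^sub>R b\<close>, where
      \<open>log_u\<close> is nonpositive, is exact up to \<open>- k * (c \<bullet> b)\<close>; this
      k makes the error at most e.\<close>
    define k where "k = e / (\<bar>c \<bullet> b\<bar> + 1)"
    have k: "k > 0" unfolding k_def using e by (intro divide_pos_pos) auto
    have "log_u x0 + c \<bullet> (k *\<^sub>R b - x0) \<le> 0"
      using c[OF sc[OF k]] log_u_nonpos[OF sc[OF k]] by simp
    moreover have "- k * (c \<bullet> b) \<le> e"
    proof -
      have "- k * (c \<bullet> b) \<le> k * (\<bar>c \<bullet> b\<bar> + 1)"
        using k mult_left_mono[of "- (c \<bullet> b)" "\<bar>c \<bullet> b\<bar> + 1" k] by simp
      also have "\<dots> = e" by (simp add: k_def add_nonneg_eq_0_iff)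
      finally show ?thesis .
    qed
    ultimately show "log_u x0 \<le> t * (c \<bullet> b) + e"
      by (simp add: x0_def inner_diff_right)
  qed
  ultimately show ?thesis unfolding x0_def by blast
qed

sublocale nonneg_directions minorants
proof
  have "(\<chi> j. -1) \<in> neg_orthant" by (simp add: neg_orthant_def)
  then show "minorants \<noteq> {}" using ex_minorant[of _ 1] by fastforce
qed (simp add: minorants_def)

section \<open>Identification of the greenification\<close>

lemma green_class_le_off_axes:
  assumes v: "v \<in> green_class unit_polydisk u" and b: "b \<in> neg_orthant"
  shows "v (torus_point b \<theta>) \<le> ereal (support_fun minorants b)"
proof -
  have v_psh: "psh_on v unit_polydisk" and v_neg: "\<And>z. z \<in> unit_polydisk \<Longrightarrow> v z \<le> 0"
    using v by (auto simp: green_class_def PSH_neg_def)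
  obtain C where C: "\<forall>\<^sub>F z in nhds 0. v z \<le> u z + ereal C"
    using v by (auto simp: green_class_def)
  let ?P = "support_fun minorants b"
  have "\<forall>\<^sub>F t in at_top. \<forall>\<theta>. v (torus_point (t *\<^sub>R b) \<theta>) \<le> u (torus_point (t *\<^sub>R b) \<theta>) + ereal C"
    by (rule eventually_torus_point_near_0[OF b C])
  then have ev: "\<forall>\<^sub>F t in at_top. v (torus_point b \<theta>) \<le> ereal (?P + (C - ?P) / (t + 1))"
    using eventually_gt_at_top[of 1]
  proof eventually_elim
    case (elim t)
    have sc: "k *\<^sub>R b \<in> neg_orthant" if "k > 0" for k
      using b that by (auto simp: neg_orthant_def mult_pos_neg)
    \<comment> \<open>The far point \<open>t *\<^sub>R b\<close> has weight
      \<open>1 / (t + 1)\<close>. At the near point only \<open>v \<le> 0\<close> is used, at the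
      far one v is at most \<open>t * ?P + C\<close>; the convex combination tends to
      \<open>?P\<close> and the constant C disappears.\<close>
    have "b = (1 / t) *\<^sub>R b + (1 / (t + 1)) *\<^sub>R (t *\<^sub>R b - (1 / t) *\<^sub>R b)"
    proof -
      have "1 / t + 1 / (t + 1) * (t - 1 / t) = 1"
        using elim(2) by (simp add: divide_simps) (simp add: algebra_simps)
      then have "b = (1 / t + 1 / (t + 1) * (t - 1 / t)) *\<^sub>R b"
        by simp
      also have "\<dots> = (1 / t) *\<^sub>R b + (1 / (t + 1)) *\<^sub>R ((t - 1 / t) *\<^sub>R b)"
        by (simp only: scaleR_add_left scaleR_scaleR)
      finally show ?thesis by (simp only: scaleR_diff_left)
    qed
    then have "v (torus_point b \<theta>) = v (torus_point ((1 / t) *\<^sub>R b + (1 / (t + 1)) *\<^sub>R (t *\<^sub>R b - (1 / t) *\<^sub>R b)) \<theta>)"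
      by simp
    also have "\<dots> \<le> ereal ((1 - 1 / (t + 1)) * 0 + 1 / (t + 1) * (log_u (t *\<^sub>R b) + C))"
    proof (rule psh_torus_convex[OF v_psh v_neg])
      show tb: "(1 / t) *\<^sub>R b \<in> neg_orthant" "t *\<^sub>R b \<in> neg_orthant"
        using elim(2) by (intro sc; simp)+
      show "v (torus_point ((1 / t) *\<^sub>R b) \<theta>) \<le> ereal 0" for \<theta>
        using v_neg[OF torus_point_mem_unit_polydisk[OF tb(1)]] by (simp add: zero_ereal_def)
      show "v (torus_point (t *\<^sub>R b) \<theta>) \<le> ereal (log_u (t *\<^sub>R b) + C)" for \<theta>
        using elim(1) by (simp add: u_torus_point[OF tb(2)])
    qed (use elim(2) in auto)
    also have "(1 - 1 / (t + 1)) * 0 + 1 / (t + 1) * (log_u (t *\<^sub>R b) + C) \<le> ?P + (C - ?P) / (t + 1)"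
    proof -
      obtain c where c: "c \<in> minorants" "log_u (t *\<^sub>R b) \<le> t * (c \<bullet> b)"
        using ex_minorant[OF b, of t] elim(2) by auto
      have "t * (c \<bullet> b) \<le> t * ?P"
        using le_support_fun[OF c(1) b] elim(2) by (intro mult_left_mono) auto
      then have "log_u (t *\<^sub>R b) + C \<le> t * ?P + C"
        using c(2) by linarith
      then have "(log_u (t *\<^sub>R b) + C) / (t + 1) \<le> (t * ?P + C) / (t + 1)"
        using elim(2) by (intro divide_right_mono) auto
      also have "(t * ?P + C) / (t + 1) = ?P + (C - ?P) / (t + 1)"
        using elim(2) by (simp add: field_simps)
      finally show ?thesis by simp
    qed
    finally show ?case by simp
  qed
  have "((\<lambda>t. ?P + (C - ?P) / (t + 1)) \<longlongrightarrow> ?P + 0) at_top"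
    by (intro tendsto_add tendsto_const tendsto_divide_0[OF tendsto_const] filterlim_at_top_imp_at_infinity
        filterlim_tendsto_add_at_top[OF tendsto_const filterlim_ident, of 1, simplified add.commute])
  then have "((\<lambda>t. ereal (?P + (C - ?P) / (t + 1))) \<longlongrightarrow> ereal ?P) at_top"
    by simp
  then show ?thesis
    using ev by (rule tendsto_lowerbound) simp
qed

lemma green_class_le:
  assumes v: "v \<in> green_class unit_polydisk u" and z: "z \<in> unit_polydisk"
  shows "v z \<le> toric_psh minorants z"
proof (rule psh_le_toric_psh[OF _ _ z])
  show "psh_on v unit_polydisk"
    using v by (simp add: green_class_def PSH_neg_def)
  fix x :: "complex ^ 'n" assume x: "x \<in> unit_polydisk" "\<And>j. x $ j \<noteq> 0"
  then obtain \<theta> where "x = torus_point (log_norm x) \<theta>"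
    using ex_torus_point_log_norm by blast
  then show "v x \<le> ereal (support_fun minorants (log_norm x))"
    using green_class_le_off_axes[OF v log_norm_mem_neg_orthant[OF x], of \<theta>] by simp
qed

lemma u_le: "z \<in> unit_polydisk \<Longrightarrow> u z \<le> toric_psh minorants z"
proof (rule green_class_le)
  show "u \<in> green_class unit_polydisk u"
    using u_PSH by (auto simp: green_class_def intro!: exI[of _ 0])
qed

text \<open>Off the hyperplanes the bound is the definition of a minorant. On them it follows from
  monotonicity of the toric function in the moduli and semicontinuity of u, by approach through
  \<open>fill_zeros\<close>.\<close>

lemma minorant_mem_green_class:
  assumes c: "c \<in> minorants"
  shows "toric_psh {c} \<in> green_class unit_polydisk u"
proof -
  interpret c: nonneg_directions "{c}"
    using c nonneg by unfold_locales auto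
  obtain C where C: "\<And>b. b \<in> neg_orthant \<Longrightarrow> c \<bullet> b \<le> log_u b + C"
    using c by (auto simp: minorants_def)
  have off: "toric_psh {c} z \<le> u z + ereal C" if z: "z \<in> unit_polydisk" "\<And>j. z $ j \<noteq> 0" for z
  proof -
    have l: "log_norm z \<in> neg_orthant"
      using log_norm_mem_neg_orthant z by blast
    obtain \<theta> where "z = torus_point (log_norm z) \<theta>"
      using ex_torus_point_log_norm z(2) by blast
    then have "u z = ereal (log_u (log_norm z))"
      using u_torus_point[OF l, of \<theta>] by simp
    then show ?thesis
      using C[OF l] c.toric_psh_eq[OF z] by (simp add: support_fun_def)
  qed
  have all: "toric_psh {c} z \<le> u z + ereal C" if z: "z \<in> unit_polydisk" for z
  proof (rule usc_fill_zeros[OF _ z])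
    show "usc_on (\<lambda>z. u z + ereal C) unit_polydisk"
      using psh by (intro usc_on_add_continuous open_unit_polydisk) (auto simp: psh_on_def)
    fix s :: real assume s: "0 < s" "s < 1"
    have "toric_psh {c} z \<le> toric_psh {c} (fill_zeros s z)"
      by (intro c.toric_psh_mono z fill_zeros_mem s norm_le_fill_zeros)
    also have "\<dots> \<le> u (fill_zeros s z) + ereal C"
      by (intro off fill_zeros_mem fill_zeros_nonzero z s)
    finally show "toric_psh {c} z \<le> u (fill_zeros s z) + ereal C" .
  qed
  have "\<forall>\<^sub>F z in nhds 0. z \<in> (unit_polydisk :: (complex ^ 'n) set)"
    by (rule eventually_nhds_in_open[OF open_unit_polydisk]) (simp add: unit_polydisk_def)
  then have "\<forall>\<^sub>F z in nhds 0. toric_psh {c} z \<le> u z + ereal C"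
    by eventually_elim (rule all)
  moreover have "toric_psh {c} \<in> PSH_neg unit_polydisk"
  proof -
    let ?z = "torus_point (\<chi> j. -1) 0 :: complex ^ 'n"
    have "(\<chi> j. -1) \<in> (neg_orthant :: (real ^ 'n) set)"
      by (simp add: neg_orthant_def)
    then have z: "?z \<in> unit_polydisk"
      by (rule torus_point_mem_unit_polydisk)
    have "toric_psh {c} ?z \<noteq> -\<infinity>"
      using c.toric_psh_eq[OF z torus_point_nonzero] by simp
    then show ?thesis
      using z c.psh_on_toric_psh c.toric_psh_nonpos unfolding PSH_neg_def by blast
  qed
  ultimately show ?thesis
    unfolding green_class_def by blast
qed

lemma toric_psh_le_SUP_green_class:
  fixes x :: "complex ^ 'n"
  assumes x: "x \<in> unit_polydisk" "\<And>j. x $ j \<noteq> 0"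
  shows "toric_psh minorants x \<le> (SUP v\<in>green_class unit_polydisk u. v x)" (is "_ \<le> ?R")
proof -
  have *: "ereal (c \<bullet> log_norm x) \<le> ?R" if c: "c \<in> minorants" for c
  proof -
    interpret c: nonneg_directions "{c}"
      using c nonneg by unfold_locales auto
    have "ereal (c \<bullet> log_norm x) = toric_psh {c} x"
      using c.toric_psh_eq[OF x] by (simp add: support_fun_def)
    also have "\<dots> \<le> ?R"
      by (intro SUP_upper minorant_mem_green_class c)
    finally show ?thesis .
  qed
  have "ereal (support_fun minorants (log_norm x)) \<le> ?R"
  \<comment> \<open>\<open>support_fun\<close> is a real supremum and \<open>?R\<close> an extended
    one: a finite \<open>?R\<close> is a bound for the former, and one minorant rules out
    -\<infinity>.\<close>
  proof (cases ?R)
    case (real r)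
    then show ?thesis using * by (auto intro!: support_fun_le)
  next
    case MInf
    then show ?thesis using * nonempty by auto
  qed auto
  then show ?thesis
    using toric_psh_eq[OF x] by simp
qed

text \<open>The supremum of the competitors is bounded by the toric function everywhere and reaches
  it off the hyperplanes. The toric function is upper semicontinuous, so regularization does not
  exceed it, and points \<open>fill_zeros s z\<close> near z recover its value on the
  hyperplanes.\<close>

lemma greenification_eq:
  assumes z: "z \<in> unit_polydisk"
  shows "greenification unit_polydisk u z = toric_psh minorants z"
proof (rule antisym)
  let ?h = "\<lambda>y. SUP v\<in>green_class unit_polydisk u. v y"
  show "greenification unit_polydisk u z \<le> toric_psh minorants z"
    unfolding greenification_def Limsup_le_iff
  proof safe
    fix y assume "toric_psh minorants z < y"
    then have "\<forall>\<^sub>F x in nhds z. toric_psh minorants x < y"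
      using usc_on_toric_psh z by (simp add: usc_on_iff_open[OF open_unit_polydisk])
    moreover have "\<forall>\<^sub>F x in nhds z. x \<in> unit_polydisk"
      by (rule eventually_nhds_in_open[OF open_unit_polydisk z])
    ultimately show "\<forall>\<^sub>F x in nhds z. ?h x < y"
    proof eventually_elim
      case (elim x)
      have "?h x \<le> toric_psh minorants x"
        using green_class_le elim(2) by (intro SUP_least)
      then show ?case using elim(1) by (rule le_less_trans)
    qed
  qed
  show "toric_psh minorants z \<le> greenification unit_polydisk u z"
  proof (rule ccontr)
    assume "\<not> ?thesis"
    then have "Limsup (nhds z) ?h < toric_psh minorants z"
      by (simp add: greenification_def)
    then have "\<forall>\<^sub>F x in nhds z. ?h x < toric_psh minorants z"
      using Limsup_le_iff[of "nhds z" ?h "Limsup (nhds z) ?h"] by simp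
    then obtain s where s: "0 < s" "s < 1" "?h (fill_zeros s z) < toric_psh minorants z"
      using eventually_fill_zeros by blast
    have "toric_psh minorants z \<le> toric_psh minorants (fill_zeros s z)"
      by (intro toric_psh_mono z fill_zeros_mem s norm_le_fill_zeros)
    also have "\<dots> \<le> ?h (fill_zeros s z)"
      by (intro toric_psh_le_SUP_green_class z fill_zeros_mem fill_zeros_nonzero s)
    finally show False using s(3) by simp
  qed
qed

section \<open>Kiselman--Lelong numbers and the indicator\<close>

lemma phi_weight_bounds:
  fixes a :: "real ^ 'n"
  assumes a: "\<And>j. a $ j > 0" and x: "x \<in> unit_polydisk" "x \<noteq> 0"
  obtains r where "r < 0" "phi_weight a x = ereal r" "\<And>j. norm (x $ j) \<le> exp (r * a $ j)"
proof -
  let ?f = "\<lambda>k. ereal (inverse (a $ k)) * ereal_log (norm (x $ k))"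
  have f: "?f k = (if x $ k = 0 then -\<infinity> else ereal (ln (norm (x $ k)) / a $ k))" for k
    using a[of k] by (simp add: ereal_log_def field_simps)
  have "Max (range ?f) \<in> range ?f"
    by (intro Max_in) auto
  then obtain k where k: "phi_weight a x = ?f k"
    unfolding phi_weight_def by (elim rangeE)
  have ge: "?f j \<le> phi_weight a x" for j
    unfolding phi_weight_def by (intro Max_ge) auto
  obtain i where "x $ i \<noteq> 0"
    using x(2) by (auto simp: vec_eq_iff)
  then have xk: "x $ k \<noteq> 0"
    using ge[of i] unfolding k f by auto
  define r where "r = ln (norm (x $ k)) / a $ k"
  have "r < 0"
    using x(1) xk a[of k] by (auto simp: r_def unit_polydisk_def divide_neg_pos)
  moreover have r: "phi_weight a x = ereal r"
    unfolding k f using xk by (simp add: r_def)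
  moreover have "norm (x $ j) \<le> exp (r * a $ j)" for j
  proof (cases "x $ j = 0")
    case False
    then have "ln (norm (x $ j)) / a $ j \<le> r"
      using ge[of j] unfolding r f by simp
    then have "ln (norm (x $ j)) \<le> r * a $ j"
      using a[of j] by (simp add: pos_divide_le_eq)
    then have "exp (ln (norm (x $ j))) \<le> exp (r * a $ j)"
      by simp
    then show ?thesis using False by simp
  qed simp
  ultimately show ?thesis using that by blast
qed

lemma kiselman_lelong_eq:
  fixes a :: "real ^ 'n"
  assumes a: "\<And>j. a $ j > 0"
  shows "kiselman_lelong u a = ereal (- support_fun minorants (- a))"
proof (rule antisym)
  let ?P = "support_fun minorants (- a)"
  have na: "- a \<in> neg_orthant" using a by (simp add: neg_orthant_def)
  have sc: "k *\<^sub>R (- a) \<in> neg_orthant" if "k > 0" for k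
    using a that by (auto simp: neg_orthant_def)
  have "\<forall>\<^sub>F x in at 0. ereal (- ?P) \<le> u x / phi_weight a x"
  proof -
    have "\<forall>\<^sub>F x in at 0. x \<in> (unit_polydisk :: (complex ^ 'n) set)"
      by (rule eventually_at_in_open'[OF open_unit_polydisk]) (simp add: unit_polydisk_def)
    moreover have "\<forall>\<^sub>F x in at 0. x \<noteq> (0 :: complex ^ 'n)"
      by (rule eventually_neq_at_within)
    ultimately show ?thesis
    proof eventually_elim
      case (elim x)
      obtain r where r: "r < 0" "phi_weight a x = ereal r" "\<And>j. norm (x $ j) \<le> exp (r * a $ j)"
        using phi_weight_bounds[OF a elim] by blast
      have ra: "(- r) *\<^sub>R (- a) \<in> neg_orthant"
        using r(1) by (intro sc) simp
      let ?w = "torus_point ((- r) *\<^sub>R (- a)) 0"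
      have w: "?w \<in> unit_polydisk" by (rule torus_point_mem_unit_polydisk[OF ra])
      have wnz: "?w $ j \<noteq> 0" for j
        by (rule torus_point_nonzero)
      \<comment> \<open>With r the weight of x, x lies in the closed polydisk with logarithmic radii
        \<open>r * a $ j\<close>. Monotonicity and homogeneity of the toric function bound u, and
        division by the negative r reverses the inequality.\<close>
      have "u x \<le> toric_psh minorants x" by (rule u_le[OF elim(1)])
      also have "\<dots> \<le> toric_psh minorants ?w"
        using r(3) by (intro toric_psh_mono elim w) simp
      also have "\<dots> = ereal (- r * ?P)"
        unfolding toric_psh_eq[OF w wnz] log_norm_torus_point
        using support_fun_scaleR[of "- r" "- a"] na r(1) by simp
      finally have ux: "u x \<le> ereal (- r * ?P)" .
      show ?case
        unfolding r(2)
      proof (cases "u x")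
        case (real w)
        then have "w \<le> - r * ?P" using ux by simp
        then have "- ?P \<le> w / r"
          using r(1) by (simp add: neg_le_divide_eq mult.commute)
        then show "ereal (- ?P) \<le> u x / ereal r"
          using real r(1) by simp
      qed (use ux r(1) in auto)
    qed
  qed
  then show "ereal (- ?P) \<le> kiselman_lelong u a"
    unfolding kiselman_lelong_def by (rule Liminf_bounded)
  show "kiselman_lelong u a \<le> ereal (- ?P)"
  proof (rule ccontr)
    assume "\<not> ?thesis"
    then have "ereal (- ?P) < kiselman_lelong u a"
      by (simp only: not_le)
    then obtain y where y: "- ?P < y" "ereal y < kiselman_lelong u a"
      using ereal_dense2[of "ereal (- ?P)" "kiselman_lelong u a"] ereal_less(1) less_ereal.simps(1) by blast
    then have "\<forall>\<^sub>F x in at 0. ereal y < u x / phi_weight a x"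
      unfolding kiselman_lelong_def by (auto dest: less_LiminfD)
    then have "\<forall>\<^sub>F x in nhds 0. x \<noteq> 0 \<longrightarrow> ereal y < u x / phi_weight a x"
      by (simp add: eventually_at_filter)
    from eventually_torus_point_near_0[OF na this]
    \<comment> \<open>On the ray in direction \<open>- a\<close> all terms of the maximum coincide,
      so the weight is exactly -t.\<close>
    have ev: "\<forall>\<^sub>F t in at_top. log_u (t *\<^sub>R (- a)) < - y * t"
      using eventually_gt_at_top[of 0]
    proof eventually_elim
      case (elim t)
      let ?x = "torus_point (t *\<^sub>R (- a)) 0"
      have "?x \<noteq> 0"
        using torus_point_nonzero[of "t *\<^sub>R (- a)" 0] by (auto simp: vec_eq_iff)
      have "ereal (inverse (a $ k)) * ereal_log (norm (?x $ k)) = ereal (- t)" for k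
        using a[of k] by (simp add: ereal_log_def field_simps)
      then have "phi_weight a ?x = ereal (- t)"
        unfolding phi_weight_def by simp
      moreover have "ereal y < u ?x / phi_weight a ?x"
        using elim(1) \<open>?x \<noteq> 0\<close> by blast
      ultimately have "ereal y < u ?x / ereal (- t)"
        by simp
      then have "y < log_u (t *\<^sub>R (- a)) / (- t)"
        unfolding u_torus_point[OF sc[OF elim(2)]] using elim(2) by simp
      then show ?case
        using elim(2) by (simp add: field_simps)
    qed
    have "support_fun minorants (- a) \<le> - y"
    \<comment> \<open>The gap k between \<open>c \<bullet> (- a)\<close> and -y grows linearly in t
      along the ray, so it beats the additive constant C of the minorant.\<close>
    proof (rule support_fun_le, rule ccontr)
      fix c assume c: "c \<in> minorants" and gt: "\<not> c \<bullet> (- a) \<le> - y"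
      obtain C where C: "\<And>b. b \<in> neg_orthant \<Longrightarrow> c \<bullet> b \<le> log_u b + C"
        using c by (auto simp: minorants_def)
      define k where "k = c \<bullet> (- a) + y"
      have k: "k > 0" using gt by (simp add: k_def)
      have "\<forall>\<^sub>F t in at_top. (t :: real) > max 1 (C / k)"
        by (rule eventually_gt_at_top)
      with ev have "\<forall>\<^sub>F t in at_top. log_u (t *\<^sub>R (- a)) < - y * t \<and> t > max 1 (C / k)"
        by (rule eventually_conj)
      from eventually_happens[OF this]
      obtain t where t: "log_u (t *\<^sub>R (- a)) < - y * t" "t > 1" "t > C / k"
        by auto
      have "t * (c \<bullet> (- a)) \<le> log_u (t *\<^sub>R (- a)) + C"
        using C[OF sc, of t] t(2) by simp
      then have "t * k < C"
        using t(1) by (simp add: k_def algebra_simps)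
      moreover have "C < t * k"
        using t(3) k by (simp add: pos_divide_less_eq)
      ultimately show False by simp
    qed
    then show False using y(1) by simp
  qed
qed

text \<open>The definite description needs uniqueness: an extension with the prescribed values is at
  most the toric function by the sub-mean value inequality and at least it by upper
  semicontinuity.\<close>

lemma psh_indicator_eq:
  assumes z: "z \<in> unit_polydisk"
  shows "psh_indicator u z = toric_psh minorants z"
proof -
  let ?E = "\<lambda>\<Psi>. \<forall>x\<in>unit_polydisk. (\<forall>j. x $ j \<noteq> 0) \<longrightarrow>
      \<Psi> x = - kiselman_lelong u (\<chi> j. - ln (norm (x $ j)))"
  let ?T = "restrict (toric_psh minorants) unit_polydisk"
  have kis: "- kiselman_lelong u (\<chi> j. - ln (norm (x $ j))) = ereal (support_fun minorants (log_norm x))"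
    if x: "x \<in> unit_polydisk" "\<And>j. x $ j \<noteq> 0" for x
  proof -
    have "- (\<chi> j. - ln (norm (x $ j))) = log_norm x"
      by (simp add: log_norm_def vec_eq_iff)
    then show ?thesis
      using log_norm_mem_neg_orthant[OF x]
      by (subst kiselman_lelong_eq) (auto simp: neg_orthant_def log_norm_def)
  qed
  have "psh_indicator u = ?T"
    unfolding psh_indicator_def
  proof (rule the_equality)
    show "?T \<in> extensional unit_polydisk \<and> psh_on ?T unit_polydisk \<and> ?E ?T"
    proof (intro conjI ballI impI)
      show "psh_on ?T unit_polydisk"
        by (rule psh_on_cong[OF psh_on_toric_psh]) simp
      fix x :: "complex ^ 'n" assume "x \<in> unit_polydisk" "\<forall>j. x $ j \<noteq> 0"
      then show "?T x = - kiselman_lelong u (\<chi> j. - ln (norm (x $ j)))"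
        using kis toric_psh_eq by simp
    qed simp
    fix \<Psi> assume \<Psi>: "\<Psi> \<in> extensional unit_polydisk \<and> psh_on \<Psi> unit_polydisk \<and> ?E \<Psi>"
    then have ext: "\<Psi> \<in> extensional unit_polydisk" and p: "psh_on \<Psi> unit_polydisk" and "?E \<Psi>"
      by blast+
    then have off: "\<Psi> x = ereal (support_fun minorants (log_norm x))"
      if "x \<in> unit_polydisk" "\<And>j. x $ j \<noteq> 0" for x
      using kis[OF that] that by simp
    show "\<Psi> = ?T"
    proof (rule extensionalityI[OF ext])
      fix x assume x: "x \<in> (unit_polydisk :: (complex ^ 'n) set)"
      have "\<Psi> x \<le> toric_psh minorants x"
        by (rule psh_le_toric_psh[OF p _ x]) (simp add: off)
      moreover have "toric_psh minorants x \<le> \<Psi> x"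
      proof (rule usc_fill_zeros[OF _ x])
        show "usc_on \<Psi> unit_polydisk" using p by (simp add: psh_on_def)
        fix s :: real assume s: "0 < s" "s < 1"
        have fx: "fill_zeros s x \<in> unit_polydisk" "\<And>j. fill_zeros s x $ j \<noteq> 0"
          using fill_zeros_mem[OF x s] fill_zeros_nonzero[OF s(1)] by blast+
        have "toric_psh minorants x \<le> toric_psh minorants (fill_zeros s x)"
          by (intro toric_psh_mono x fx norm_le_fill_zeros s)
        then show "toric_psh minorants x \<le> \<Psi> (fill_zeros s x)"
          using off[OF fx] toric_psh_eq[OF fx] by simp
      qed
      ultimately show "\<Psi> x = ?T x" using x by simp
    qed simp
  qed
  then show ?thesis using z by simp
qed

end

theorem theorem3p1:
  fixes u :: "complex ^ 'n \<Rightarrow> ereal"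
  assumes "u \<in> PSH_neg unit_polydisk"
    and "multicircled_on u unit_polydisk"
  shows "\<forall>z\<in>unit_polydisk. greenification unit_polydisk u z = psh_indicator u z"
proof -
  interpret multicircled_psh u
    using assms by unfold_locales
  show ?thesis
    by (simp add: greenification_eq psh_indicator_eq)
qed

end
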